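(* Let $T$ be a free $\mathbb{Z}$-module of finite rank endowed with the action of an automorphism group $G$ of prime order $p$. Let $r$, $\ell_-(T)=s$ and $\ell_+(T)=t$ be the integers in the decomposition $T\simeq\bigoplus_{i=1}^{r}(A_i,a_i)\oplus\bigoplus_{i=r+1}^{r+s}A_i\oplus\mathbb{Z}^{t}$ of $\mathbb{Z}[G]$-modules. Then: (i) $\ell_p(T)=r$; (ii) if $p\geq3$, $\ell_+(T)=\ell_1(T)$ and $\ell_-(T)=\ell_{p-1}(T)$; (iii) if $p=2$, $\ell_1(T)=\ell_+(T)+\ell_-(T)$; (iv) for all $2\leq q\leq p-2$, $\ell_q(T)=0$; (v) $\mathrm{rk}\,T=\ell_+(T)+(p-1)\ell_-(T)+p\,\ell_p(T)$ and $\mathrm{rk}\,T^G=\ell_+(T)+\ell_p(T)$.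
   Context: Write $G=\langle\phi\rangle$; $T^G$ is the submodule of invariants. For a finite-dimensional $\mathbb{F}_p$-vector space $V$ with an action of $G$, the Jordan decomposition gives $V\simeq\bigoplus_{q=1}^{p}N_q^{\oplus\ell_q(V)}$, where $N_q$ is the $\mathbb{F}_p[G]$-module of dimension $q$ on which $\phi$ acts, in a suitable basis, by a single unipotent Jordan block of size $q$ (ones on the diagonal and superdiagonal). For a finitely generated $\mathbb{Z}$-module $T$ with an action of $G$, $\ell_q(T):=\ell_q(T\otimes\mathbb{F}_p)$. Let $\xi_p$ be a primitive $p$-th root of unity and $\mathcal{O}=\mathbb{Z}[\xi_p]$. An ideal $A$ of $\mathcal{O}$ is a $\mathbb{Z}[G]$-module via $\phi\cdot x=\xi_p x$; for $a\in A$, $(A,a)$ denotes $A\oplus\mathbb{Z}$ with $\phi\cdot(x,k)=(\xi_p x+ka,k)$. It is known (Curtis–Reiner) that every $T$ as in the claim is isomorphic as a $\mathbb{Z}[G]$-module to $\bigoplus_{i=1}^{r}(A_i,a_i)\oplus\bigoplus_{i=r+1}^{r+s}A_i\oplus\mathbb{Z}^{t}$, where $G$ acts trivially on $\mathbb{Z}^t$, the $A_i$ are nonzero ideals of $\mathcal{O}$ and $a_i\in A_i$ with $a_i\notin(\xi_p-1)A_i$; the integers $r,s,t$ are uniquely determined by the $\mathbb{Z}[G]$-module structure of $T$. *)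

theory Defs
  imports
    "HOL-Algebra.Bij"
    "HOL-Algebra.Product_Groups"
    "HOL-Algebra.Free_Abelian_Groups"
    "Jordan_Normal_Form.Jordan_Normal_Form"
    "Jordan_Normal_Form.VS_Connect"
    "Berlekamp_Zassenhaus.Finite_Field"
begin

text \<open>
  Conventions. A \<open>\<int>\<close>-module is an abelian group in the (multiplicatively written) sense of
  HOL-Algebra. A \<open>\<int>[G]\<close>-module, for \<open>G\<close> generated by \<open>\<phi>\<close>, is such a group together with the
  action of \<open>\<phi>\<close>. Likewise an \<open>F\<^sub>p[G]\<close>-module is a HOL-Algebra module over
  \<^term>\<open>class_ring :: 'p::prime_card mod_ring ring\<close> together with the action of \<open>\<phi>\<close>; here \<open>p\<close> is
  the cardinality of the type \<open>'p\<close>, which is prime by its sort.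
\<close>


subsection \<open>Free abelian groups and equivariant isomorphisms\<close>

definition free_of_rank :: "('a, 'm) monoid_scheme \<Rightarrow> nat \<Rightarrow> bool" where
  "free_of_rank T n \<longleftrightarrow> comm_group T \<and> T \<cong> free_Abelian_group {..<n}"

definition rk :: "('a, 'm) monoid_scheme \<Rightarrow> nat" where
  "rk T = (THE n. free_of_rank T n)"

definition invariants :: "('a, 'm) monoid_scheme \<Rightarrow> ('a \<Rightarrow> 'a) set \<Rightarrow> ('a, 'm) monoid_scheme" where
  "invariants T G = T\<lparr>carrier := {x \<in> carrier T. \<forall>g\<in>G. g x = x}\<rparr>"

definition ZG_isomorphic ::
  "('a, 'm) monoid_scheme \<Rightarrow> ('a \<Rightarrow> 'a) \<Rightarrow> ('b, 'n) monoid_scheme \<Rightarrow> ('b \<Rightarrow> 'b) \<Rightarrow> bool" where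
  "ZG_isomorphic T \<phi> U \<psi> \<longleftrightarrow> (\<exists>f \<in> iso T U. \<forall>x \<in> carrier T. f (\<phi> x) = \<psi> (f x))"

definition FpG_isomorphic ::
  "('p::prime_card mod_ring, 'v) module \<Rightarrow> ('v \<Rightarrow> 'v) \<Rightarrow>
   ('p mod_ring, 'w) module \<Rightarrow> ('w \<Rightarrow> 'w) \<Rightarrow> bool" where
  "FpG_isomorphic V \<phi> W \<psi> \<longleftrightarrow>
     (\<exists>f \<in> LinearCombinations.module_hom class_ring V W.
        bij_betw f (carrier V) (carrier W) \<and> (\<forall>v \<in> carrier V. f (\<phi> v) = \<psi> (f v)))"


subsection \<open>The Jordan multiplicities of a finite-dimensional \<open>F\<^sub>p[G]\<close>-module\<close>

text \<open>
  The direct sum of \<open>l q\<close> copies of \<open>N\<^sub>q\<close> for \<open>1 \<le> q \<le> p\<close>, where \<open>N\<^sub>q\<close> is the space of column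
  vectors of length \<open>q\<close> with \<open>\<phi>\<close> acting through \<^term>\<open>jordan_block q 1\<close>. The copies are indexed by
  the pairs \<open>(q, j)\<close> with \<open>j < l q\<close>; as in \<^const>\<open>module_vec\<close>, the multiplicative fields of the
  module record are irrelevant.
\<close>

definition jordan_idx :: "nat \<Rightarrow> (nat \<Rightarrow> nat) \<Rightarrow> (nat \<times> nat) set" where
  "jordan_idx p l = (SIGMA q:{1..p}. {..<l q})"

definition jordan_sum :: "(nat \<Rightarrow> nat) \<Rightarrow> ('p::prime_card mod_ring, nat \<times> nat \<Rightarrow> 'p mod_ring vec) module"
  where
  "jordan_sum l =
    (let I = jordan_idx CARD('p) l; N = (\<lambda>i. module_vec TYPE('p mod_ring) (fst i)) in
     \<lparr> carrier = (\<Pi>\<^sub>E i\<in>I. carrier (N i)),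
       monoid.mult = undefined,
       one = undefined,
       zero = (\<lambda>i\<in>I. \<zero>\<^bsub>N i\<^esub>),
       add = (\<lambda>v w. \<lambda>i\<in>I. v i \<oplus>\<^bsub>N i\<^esub> w i),
       smult = (\<lambda>c v. \<lambda>i\<in>I. c \<odot>\<^bsub>N i\<^esub> v i) \<rparr>)"

definition jordan_sum_act ::
  "(nat \<Rightarrow> nat) \<Rightarrow> (nat \<times> nat \<Rightarrow> 'p::prime_card mod_ring vec) \<Rightarrow> nat \<times> nat \<Rightarrow> 'p mod_ring vec" where
  "jordan_sum_act l v = (\<lambda>i \<in> jordan_idx CARD('p) l. jordan_block (fst i) 1 *\<^sub>v v i)"

definition jordan_mult :: "('p::prime_card mod_ring, 'v) module \<Rightarrow> ('v \<Rightarrow> 'v) \<Rightarrow> nat \<Rightarrow> nat" where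
  "jordan_mult V \<phi> q = (THE m. \<exists>l. FpG_isomorphic V \<phi> (jordan_sum l) (jordan_sum_act l) \<and> m = l q)"


subsection \<open>Tensor product of abelian groups, and base change to \<open>F\<^sub>p\<close>\<close>

definition tensor_rels ::
  "('a, 'm) monoid_scheme \<Rightarrow> ('b, 'n) monoid_scheme \<Rightarrow> ('a \<times> 'b \<Rightarrow>\<^sub>0 int) set" where
  "tensor_rels M N = generate (free_Abelian_group (carrier M \<times> carrier N))
     ({frag_of (x \<otimes>\<^bsub>M\<^esub> y, z) - frag_of (x, z) - frag_of (y, z) | x y z.
         x \<in> carrier M \<and> y \<in> carrier M \<and> z \<in> carrier N} \<union>
      {frag_of (x, y \<otimes>\<^bsub>N\<^esub> z) - frag_of (x, y) - frag_of (x, z) | x y z.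
         x \<in> carrier M \<and> y \<in> carrier N \<and> z \<in> carrier N})"

definition tensor ::
  "('a, 'm) monoid_scheme \<Rightarrow> ('b, 'n) monoid_scheme \<Rightarrow> ('a \<times> 'b \<Rightarrow>\<^sub>0 int) set monoid" where
  "tensor M N = free_Abelian_group (carrier M \<times> carrier N) Mod tensor_rels M N"

text \<open>
  The endomorphism of the tensor product induced by endomorphisms \<open>g\<close> and \<open>h\<close> of the factors: the
  pointwise image of a coset under the induced map of free abelian groups need not be a whole coset,
  hence the multiplication by the subgroup of relations.
\<close>

definition tensor_map ::
  "('a, 'm) monoid_scheme \<Rightarrow> ('b, 'n) monoid_scheme \<Rightarrow> ('a \<Rightarrow> 'a) \<Rightarrow> ('b \<Rightarrow> 'b) \<Rightarrow>
   ('a \<times> 'b \<Rightarrow>\<^sub>0 int) set \<Rightarrow> ('a \<times> 'b \<Rightarrow>\<^sub>0 int) set" where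
  "tensor_map M N g h X =
     tensor_rels M N <#>\<^bsub>free_Abelian_group (carrier M \<times> carrier N)\<^esub>
       (frag_extend (\<lambda>(x, y). frag_of (g x, h y)) ` X)"

abbreviation Fp_group :: "'p::prime_card itself \<Rightarrow> 'p mod_ring monoid" where
  "Fp_group _ \<equiv> \<lparr> carrier = UNIV, monoid.mult = (+), one = 0 \<rparr>"

definition Fp_tensor :: "'p::prime_card itself \<Rightarrow> ('a, 'm) monoid_scheme \<Rightarrow>
    ('p mod_ring, ('a \<times> 'p mod_ring \<Rightarrow>\<^sub>0 int) set) module" where
  "Fp_tensor ty T =
     \<lparr> carrier = carrier (tensor T (Fp_group ty)),
       monoid.mult = undefined,
       one = undefined,
       zero = \<one>\<^bsub>tensor T (Fp_group ty)\<^esub>,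
       add = (\<lambda>X Y. X \<otimes>\<^bsub>tensor T (Fp_group ty)\<^esub> Y),
       smult = (\<lambda>c. tensor_map T (Fp_group ty) (\<lambda>x. x) (\<lambda>z. c * z)) \<rparr>"

definition ell :: "'p::prime_card itself \<Rightarrow> ('a, 'm) monoid_scheme \<Rightarrow> ('a \<Rightarrow> 'a) \<Rightarrow> nat \<Rightarrow> nat" where
  "ell ty T \<phi> q = jordan_mult (Fp_tensor ty T) (tensor_map T (Fp_group ty) \<phi> (\<lambda>z. z)) q"


subsection \<open>The \<open>\<int>[G]\<close>-modules of the integral decomposition\<close>

definition primitive_root_of_unity :: "nat \<Rightarrow> complex \<Rightarrow> bool" where
  "primitive_root_of_unity p \<xi> \<longleftrightarrow> \<xi> ^ p = 1 \<and> (\<forall>k. 0 < k \<and> k < p \<longrightarrow> \<xi> ^ k \<noteq> 1)"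

definition Z_adjoin :: "complex \<Rightarrow> complex ring" where
  "Z_adjoin \<xi> = class_ring\<lparr>carrier := range (\<lambda>f :: int poly. poly (map_poly of_int f) \<xi>)\<rparr>"

definition ideal_group :: "complex set \<Rightarrow> complex monoid" where
  "ideal_group A = \<lparr> carrier = A, monoid.mult = (+), one = 0 \<rparr>"

text \<open>The action of \<open>\<phi>\<close> on \<open>(A, a)\<close>, whose underlying group is \<open>A \<oplus> \<int>\<close>.\<close>

definition ext_act :: "complex \<Rightarrow> complex \<Rightarrow> complex \<times> int \<Rightarrow> complex \<times> int" where
  "ext_act \<xi> a = (\<lambda>(x, k). (\<xi> * x + of_int k * a, k))"

text \<open>The three direct sums are finite, so they are products of groups.\<close>

definition decomp_group ::
  "nat \<Rightarrow> nat \<Rightarrow> nat \<Rightarrow> (nat \<Rightarrow> complex set) \<Rightarrow>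
   ((nat \<Rightarrow> complex \<times> int) \<times> (nat \<Rightarrow> complex) \<times> (nat \<Rightarrow> int)) monoid" where
  "decomp_group r s t A =
     product_group {1..r} (\<lambda>i. ideal_group (A i) \<times>\<times> integer_group) \<times>\<times>
     (product_group {r+1..r+s} (\<lambda>i. ideal_group (A i)) \<times>\<times>
      product_group {1..t} (\<lambda>_. integer_group))"

definition decomp_act ::
  "complex \<Rightarrow> nat \<Rightarrow> nat \<Rightarrow> (nat \<Rightarrow> complex) \<Rightarrow>
   (nat \<Rightarrow> complex \<times> int) \<times> (nat \<Rightarrow> complex) \<times> (nat \<Rightarrow> int) \<Rightarrow>
   (nat \<Rightarrow> complex \<times> int) \<times> (nat \<Rightarrow> complex) \<times> (nat \<Rightarrow> int)" where
  "decomp_act \<xi> r s a =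
     (\<lambda>(u, v, w). (\<lambda>i\<in>{1..r}. ext_act \<xi> (a i) (u i), \<lambda>i\<in>{r+1..r+s}. \<xi> * v i, w))"

definition has_decomposition ::
  "complex \<Rightarrow> ('a, 'm) monoid_scheme \<Rightarrow> ('a \<Rightarrow> 'a) \<Rightarrow> nat \<Rightarrow> nat \<Rightarrow> nat \<Rightarrow> bool" where
  "has_decomposition \<xi> T \<phi> r s t \<longleftrightarrow>
     (\<exists>A a.
        (\<forall>i\<in>{1..r+s}. ideal (A i) (Z_adjoin \<xi>) \<and> A i \<noteq> {0}) \<and>
        (\<forall>i\<in>{1..r}. a i \<in> A i \<and> a i \<notin> (\<lambda>x. (\<xi> - 1) * x) ` A i) \<and>
        ZG_isomorphic T \<phi> (decomp_group r s t A) (decomp_act \<xi> r s a))"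

end

(* Everything is read off a surjection pi from T onto an F_p-module W with kernel pT: it induces
   T (x) F_p = W, so it suffices to write down such a pi, compatible with phi, into a direct sum of
   Jordan blocks. Put theta = xi - 1. Expanding (1 + theta)^p = 1 gives theta^(p-1) O = p O, and an
   element of least theta-adic valuation shows that every a in A outside theta A satisfies
   A = Z a + theta A. Hence a, theta a, ..., theta^(p-2) a is a basis of A / p A and a Jordan chain
   for phi, which in (A, a) is prolonged by (0, 1) to a chain of length p. That p^k A shrinks to 0
   is inherited from T, because A embeds into a free group. The multiplicities of the blocks are
   unique because |ker (phi - 1)^k| determines them; the rank of T is recovered from |T / p T|; and
   the invariants of (A, a) project isomorphically onto p Z. *)

theory Submission
  imports Defs
begin

section \<open>Reduction modulo \<open>p\<close> as a tensor product\<close>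

text \<open>The decomposition hands over the A_i as bare ideals, without Z-bases, so the linear
  algebra modulo p rests on digit expansions to the base \<theta>. Two facts carry them:
  \<theta>^(p-1) = -p (1 + \<theta> g), whose cofactor is congruent to 1 modulo \<theta>, and the
  cancellation of integers prime to p modulo \<theta> A. Digits are determined only modulo p, which
  is all that a map into an F_p-module sees; expansions have length p - 1 because \<theta>^(p-1) A =
  p A. For i <= r the chain must begin at the given a_i, since \<phi> - 1 sends (0, 1) to (a_i, 0).
  Hence the coordinates are built for an arbitrary a outside \<theta> A, and for i > r such an
  element is chosen. \<open>ell\<close> and \<open>rk\<close> are definite descriptions, so each
  value calls for existence and uniqueness. A block of size q contributes min k q dimensions to the
  kernel of (\<phi> - 1)^k, and the second difference of this in k detects q. For p = 2 the block
  sizes p - 1 and 1 coincide; additive multiplicities and a shift of indices keep the treatment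
  uniform.\<close>

lemma tensor_rels_normal:
  assumes "group M" "group N"
  shows "tensor_rels M N \<lhd> free_Abelian_group (carrier M \<times> carrier N)"
proof -
  interpret F: comm_group "free_Abelian_group (carrier M \<times> carrier N)"
    by (rule abelian_free_Abelian_group)
  interpret M: group M by fact
  interpret N: group N by fact
  show ?thesis
    unfolding tensor_rels_def
    by (intro F.subgroup_imp_normal F.generate_is_subgroup)
       (auto dest!: subsetD[OF keys_diff] simp: keys_frag_of)
qed

text \<open>As \<open>g\<close> and \<open>h\<close> are additive, each bilinearity relation goes to
  a relation of the same kind, so the induced map preserves the subgroup that they generate.\<close>

lemma frag_extend_tensor_rels:
  assumes M: "group M" and N: "group N" and g: "g \<in> hom M M" and h: "h \<in> hom N N"
    and x: "x \<in> tensor_rels M N"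
  shows "frag_extend (\<lambda>(x, y). frag_of (g x, h y)) x \<in> tensor_rels M N"
proof -
  interpret M: group M by fact
  interpret N: group N by fact
  have g': "g y \<in> carrier M" if "y \<in> carrier M" for y using g that by (auto simp: hom_def)
  have h': "h y \<in> carrier N" if "y \<in> carrier N" for y using h that by (auto simp: hom_def)
  define S where "S = carrier M \<times> carrier N"
  define R where "R = {frag_of (x \<otimes>\<^bsub>M\<^esub> y, z) - frag_of (x, z) - frag_of (y, z) | x y z.
         x \<in> carrier M \<and> y \<in> carrier M \<and> z \<in> carrier N} \<union>
      {frag_of (x, y \<otimes>\<^bsub>N\<^esub> z) - frag_of (x, y) - frag_of (x, z) | x y z.
         x \<in> carrier M \<and> y \<in> carrier N \<and> z \<in> carrier N}"
  have rels: "tensor_rels M N = generate (free_Abelian_group S) R"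
    by (simp add: tensor_rels_def S_def R_def)
  have RS: "Poly_Mapping.keys r \<subseteq> S" if "r \<in> R" for r
    using that by (auto simp: R_def S_def dest!: subsetD[OF keys_diff])
  have RR: "frag_extend (\<lambda>(x, y). frag_of (g x, h y)) r \<in> R" if "r \<in> R" for r
    using that unfolding R_def
  proof (elim UnE CollectE exE conjE, goal_cases)
    case (1 x y z)
    then show ?case 
      by (intro UnI1 CollectI exI[of _ "g x"] exI[of _ "g y"] exI[of _ "h z"])
         (auto simp: frag_extend_diff hom_mult[OF g] intro: g' h')
  next
    case (2 x y z)
    then show ?case
      by (intro UnI2 CollectI exI[of _ "g x"] exI[of _ "h y"] exI[of _ "h z"])
         (auto simp: frag_extend_diff hom_mult[OF h] intro: g' h')
  qed
  show ?thesis using x unfolding rels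
  proof (induction rule: generate.induct)
    case one
    show ?case using generate.one[of "free_Abelian_group S" R] by simp
  next
    case (incl r)
    then show ?case by (intro generate.incl RR)
  next
    case (inv r)
    then show ?case using generate.inv[OF RR[OF inv], of "free_Abelian_group S"]
      by (simp add: RS RR frag_extend_minus)
  next
    case (eng r1 r2)
    then show ?case using generate.eng[OF eng(3,4)] by (simp add: frag_extend_add)
  qed
qed

text \<open>The images of the relations are absorbed by the factor \<open>tensor_rels\<close> in
  \<open>tensor_map\<close>; the induced map can therefore be computed on any
  representative.\<close>

lemma tensor_map_coset:
  assumes M: "group M" and N: "group N" and g: "g \<in> hom M M" and h: "h \<in> hom N N"
    and x: "x \<in> carrier (free_Abelian_group (carrier M \<times> carrier N))"
  shows "tensor_map M N g h (tensor_rels M N #>\<^bsub>free_Abelian_group (carrier M \<times> carrier N)\<^esub> x) =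
    tensor_rels M N #>\<^bsub>free_Abelian_group (carrier M \<times> carrier N)\<^esub>
      frag_extend (\<lambda>(x, y). frag_of (g x, h y)) x"
proof -
  interpret F: comm_group "free_Abelian_group (carrier M \<times> carrier N)"
    by (rule abelian_free_Abelian_group)
  interpret R: normal "tensor_rels M N" "free_Abelian_group (carrier M \<times> carrier N)"
    by (rule tensor_rels_normal[OF M N])
  note RF = frag_extend_tensor_rels[OF M N g h]
  have R0: "0 \<in> tensor_rels M N"
    using R.one_closed by simp
  have R_add: "a + b \<in> tensor_rels M N" if "a \<in> tensor_rels M N" "b \<in> tensor_rels M N" for a b
    using R.m_closed[OF that] by simp
  let ?F = "frag_extend (\<lambda>(x, y). frag_of (g x, h y))"
  have "(\<exists>a\<in>tensor_rels M N. \<exists>b\<in>tensor_rels M N. z = a + ?F (b + x)) \<longleftrightarrow>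
    (\<exists>a\<in>tensor_rels M N. z = a + ?F x)" for z
  proof
    assume "\<exists>a\<in>tensor_rels M N. \<exists>b\<in>tensor_rels M N. z = a + ?F (b + x)"
    then obtain a b where "a \<in> tensor_rels M N" "b \<in> tensor_rels M N" "z = (a + ?F b) + ?F x"
      by (auto simp: frag_extend_add add.assoc)
    then show "\<exists>a\<in>tensor_rels M N. z = a + ?F x"
      using R_add RF by blast
  next
    assume "\<exists>a\<in>tensor_rels M N. z = a + ?F x"
    then show "\<exists>a\<in>tensor_rels M N. \<exists>b\<in>tensor_rels M N. z = a + ?F (b + x)"
      using R0 by (metis add_0)
  qed
  then show ?thesis
    by (auto simp: tensor_map_def set_mult_def r_coset_def)
qed


lemma group_Fp_group: "group (Fp_group TYPE('p::prime_card))"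
  by (rule groupI) (auto intro: exI[of _ "- _"] simp: add.assoc)

text \<open>Together \<open>surj\<close> and \<open>ker\<close> say that \<open>\<pi>\<close>
  identifies T / pT with \<open>W\<close>. The inclusion opposite to \<open>ker\<close> is
  automatic, because p annihilates the F_p-module \<open>W\<close>.\<close>

locale mod_p_reduction = T: comm_group T + W: module "class_ring :: 'p mod_ring ring" W
  for T :: "('a, 'm) monoid_scheme" and W :: "('p::prime_card mod_ring, 'w) module" +
  fixes \<pi> :: "'a \<Rightarrow> 'w"
  assumes hom: "\<pi> \<in> hom T (add_monoid W)"
    and surj: "\<pi> ` carrier T = carrier W"
    and ker: "\<And>x. x \<in> carrier T \<Longrightarrow> \<pi> x = \<zero>\<^bsub>W\<^esub> \<Longrightarrow> \<exists>y\<in>carrier T. x = y [^]\<^bsub>T\<^esub> CARD('p)"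
begin

abbreviation F where "F \<equiv> free_Abelian_group (carrier T \<times> (UNIV :: 'p mod_ring set))"
abbreviation R where "R \<equiv> tensor_rels T (Fp_group TYPE('p))"

lemma pi_closed: "x \<in> carrier T \<Longrightarrow> \<pi> x \<in> carrier W"
  using hom by (auto simp: hom_def)

lemma pi_mult: "x \<in> carrier T \<Longrightarrow> y \<in> carrier T \<Longrightarrow> \<pi> (x \<otimes>\<^bsub>T\<^esub> y) = \<pi> x \<oplus>\<^bsub>W\<^esub> \<pi> y"
  using hom by (auto simp: hom_def)

sublocale Rel: normal R F
  using tensor_rels_normal[OF T.group_axioms group_Fp_group[where 'p='p]] by simp

lemma R_add: "x \<in> R \<Longrightarrow> y \<in> R \<Longrightarrow> x + y \<in> R"
  using subgroup.m_closed[OF Rel.subgroup_axioms] by simp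

lemma R_minus:
  assumes "x \<in> R" shows "- x \<in> R"
proof -
  have "Poly_Mapping.keys x \<subseteq> carrier T \<times> UNIV"
    using Rel.mem_carrier[OF assms] by simp
  then show ?thesis using Rel.m_inv_closed[OF assms] by simp
qed

lemma R_coset_eq: 
  assumes "x \<in> carrier F" "y \<in> carrier F"
  shows "R #>\<^bsub>F\<^esub> x = R #>\<^bsub>F\<^esub> y \<longleftrightarrow> x - y \<in> R"
proof -
  have "R #>\<^bsub>F\<^esub> x = R #>\<^bsub>F\<^esub> y \<longleftrightarrow> x \<in> R #>\<^bsub>F\<^esub> y"
    using Rel.repr_independence[of x R y] Rel.rcos_self[of x R] Rel.subgroup_axioms assms by auto
  also have "\<dots> \<longleftrightarrow> x - y \<in> R"
    using Rel.rcos_module[OF Rel.is_group] assms by simp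
  finally show ?thesis .
qed

section \<open>Calculating with pure tensors modulo the bilinearity relations\<close>

lemma R_add_left:
  "x \<in> carrier T \<Longrightarrow> y \<in> carrier T \<Longrightarrow> frag_of (x \<otimes>\<^bsub>T\<^esub> y, c) - frag_of (x, c) - frag_of (y, c) \<in> R"
  unfolding tensor_rels_def by (rule generate.incl) auto

lemma R_add_right:
  "x \<in> carrier T \<Longrightarrow> frag_of (x, c + d) - frag_of (x, c) - frag_of (x, d) \<in> R"
  unfolding tensor_rels_def by (rule generate.incl, rule UnI2) auto

text \<open>The additivity relation at c = d = 0 collapses to minus the generator in question;
  \<open>R_one_left\<close> works in the same way.\<close>

lemma R_zero_right: "x \<in> carrier T \<Longrightarrow> frag_of (x, 0) \<in> R"
  using R_minus[OF R_add_right[of x 0 0]] by simp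

lemma R_one_left: "frag_of (\<one>\<^bsub>T\<^esub>, c) \<in> R"
  using R_minus[OF R_add_left[of "\<one>\<^bsub>T\<^esub>" "\<one>\<^bsub>T\<^esub>" c]] by simp

text \<open>Integers move across the tensor sign. This serves twice: it brings every pure tensor
  into the form t (x) 1, and it kills p-th powers, since p = 0 on the right.\<close>

lemma R_pow:
  assumes x: "x \<in> carrier T"
  shows "frag_of (x [^]\<^bsub>T\<^esub> n, 1) - frag_of (x, of_nat n) \<in> R"
proof (induction n)
  case 0
  show ?case using R_add[OF R_one_left R_minus[OF R_zero_right[OF x]]] by simp
next
  case (Suc n)
  \<comment> \<open>The difference telescopes into additivity on the left, minus additivity on the
    right, and the induction hypothesis.\<close>
  have "frag_of (x [^]\<^bsub>T\<^esub> Suc n, 1) - frag_of (x, of_nat (Suc n)) =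
    (frag_of (x [^]\<^bsub>T\<^esub> n \<otimes>\<^bsub>T\<^esub> x, 1) - frag_of (x [^]\<^bsub>T\<^esub> n, 1) - frag_of (x, 1))
    + - (frag_of (x, of_nat n + 1) - frag_of (x, of_nat n) - frag_of (x, 1)) 
    + (frag_of (x [^]\<^bsub>T\<^esub> n, 1) - frag_of (x, of_nat n))"
    by (simp add: add.commute)
  also have "\<dots> \<in> R"
    by (intro R_add R_minus Suc R_add_left R_add_right x T.nat_pow_closed)
  finally show ?case .
qed

text \<open>F_p is generated by 1 as a group, so every tensor is a single t (x) 1. The induction
  runs over differences, which are absorbed by taking t times the inverse of u.\<close>

lemma coset_representative:
  assumes "Poly_Mapping.keys x \<subseteq> carrier T \<times> UNIV"
  shows "\<exists>t\<in>carrier T. x - frag_of (t, 1) \<in> R"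
  using assms
proof (rule free_Abelian_group_induct, goal_cases)
  case 1
  show ?case using R_minus[OF R_one_left] by (intro bexI[of _ "\<one>\<^bsub>T\<^esub>"]) auto
next
  case (2 x y)
  then obtain t u where t: "t \<in> carrier T" "x - frag_of (t, 1) \<in> R"
    and u: "u \<in> carrier T" "y - frag_of (u, 1) \<in> R" by blast
  define v where "v = t \<otimes>\<^bsub>T\<^esub> inv\<^bsub>T\<^esub> u"
  have v: "v \<in> carrier T" "v \<otimes>\<^bsub>T\<^esub> u = t" using t u by (auto simp: v_def T.m_assoc)
  have "x - y - frag_of (v, 1) = (x - frag_of (t, 1)) + - (y - frag_of (u, 1)) 
    + (frag_of (v \<otimes>\<^bsub>T\<^esub> u, 1) - frag_of (v, 1) - frag_of (u, 1))"
    by (simp add: v(2))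
  also have "\<dots> \<in> R"
    by (intro R_add R_minus R_add_left t u v)
  finally show ?case using v by blast
next
  case (3 z)
  obtain t c where z: "z = (t, c)" "t \<in> carrier T" using 3 by auto
  obtain n where "c = of_nat n" using surj_of_nat_mod_ring[of c] by auto
  then show ?case
    using R_minus[OF R_pow[OF z(2), of n]] z by (intro bexI[of _ "t [^]\<^bsub>T\<^esub> n"]) auto
qed

text \<open>Injectivity of the induced map: the quotient of t and u is a p-th power of some y, and
  its tensor with 1 equals y (x) p = 0.\<close>

lemma pi_eq_imp_coset_eq:
  assumes t: "t \<in> carrier T" and u: "u \<in> carrier T" and eq: "\<pi> t = \<pi> u"
  shows "frag_of (t, 1) - frag_of (u, 1) \<in> R"
proof -
  define v where "v = t \<otimes>\<^bsub>T\<^esub> inv\<^bsub>T\<^esub> u"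
  have v: "v \<in> carrier T" "v \<otimes>\<^bsub>T\<^esub> u = t" using t u by (auto simp: v_def T.m_assoc)
  have "\<pi> v \<oplus>\<^bsub>W\<^esub> \<pi> u = \<pi> u" using pi_mult[OF v(1) u] v eq by simp
  then have "\<pi> v = \<zero>\<^bsub>W\<^esub>"
    using pi_closed[OF v(1)] pi_closed[OF u] W.add.r_cancel_one' by metis
  then obtain y where y: "y \<in> carrier T" "v = y [^]\<^bsub>T\<^esub> CARD('p)" using ker v by blast
  have "frag_of (v, 1) \<in> R"
    using R_add[OF R_pow[OF y(1), of "CARD('p)"] R_zero_right[OF y(1)]] by (simp add: y)
  moreover have "frag_of (v \<otimes>\<^bsub>T\<^esub> u, 1) - frag_of (v, 1) - frag_of (u, 1) \<in> R"
    by (intro R_add_left u v)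
  ultimately have "frag_of (v, 1) + (frag_of (v \<otimes>\<^bsub>T\<^esub> u, 1) - frag_of (v, 1) - frag_of (u, 1)) \<in> R"
    by (rule R_add)
  then show ?thesis by (simp add: v(2))
qed

text \<open>The universal property of the tensor product, applied to the bilinear map that sends (x,
  c) to c times \<open>\<pi> x\<close>.\<close>

lemma ex_coset_map:
  obtains f where "f \<in> hom (F Mod R) (add_monoid W)"
    "\<And>x c. x \<in> carrier T \<Longrightarrow> f (R #>\<^bsub>F\<^esub> frag_of (x, c)) = c \<odot>\<^bsub>W\<^esub> \<pi> x"
proof -
  have "(\<lambda>(x, c). c \<odot>\<^bsub>W\<^esub> \<pi> x) ` (carrier T \<times> UNIV) \<subseteq> carrier (add_monoid W)"
    using pi_closed by auto
  from comm_group.free_Abelian_group_universal[OF W.a_comm_group this] obtain h where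
    h: "h \<in> hom F (add_monoid W)"
    and h_of': "\<And>z. z \<in> carrier T \<times> UNIV \<Longrightarrow> h (frag_of z) = (\<lambda>(x, c). c \<odot>\<^bsub>W\<^esub> \<pi> x) z" 
    by blast
  have h_of: "h (frag_of (x, c)) = c \<odot>\<^bsub>W\<^esub> \<pi> x" if "x \<in> carrier T" for x c
    using h_of'[of "(x, c)"] that by simp
  interpret h: group_hom F "add_monoid W" h
    using h by (auto simp: group_hom_def group_hom_axioms_def W.a_group)
  \<comment> \<open>Both families of relations have the shape a - b - c, so one cancellation rule
    reduces each of them to a distributive law in \<open>W\<close>.\<close>
  have h_cancel: "h (a - b - c) = \<zero>\<^bsub>W\<^esub>"
    if "a \<in> carrier F" "b \<in> carrier F" "c \<in> carrier F" "h a = h b \<oplus>\<^bsub>W\<^esub> h c" for a b c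
  proof -
    have "a - b - c \<in> carrier F"
      using that by (auto dest!: subsetD[OF keys_diff])
    moreover have "b + c \<in> carrier F"
      using that keys_add[of b c] by auto
    ultimately have "h ((a - b - c) + (b + c)) = h (a - b - c) \<oplus>\<^bsub>W\<^esub> h (b + c)"
      using h.hom_mult[of "a - b - c" "b + c"] by simp
    moreover have "h (b + c) = h a"
      using h.hom_mult[of b c] that by simp
    ultimately have "h a = h (a - b - c) \<oplus>\<^bsub>W\<^esub> h a" by simp
    then show ?thesis
      using h.hom_closed that \<open>a - b - c \<in> carrier F\<close> W.add.r_cancel_one' by auto
  qed
  have "R \<subseteq> kernel F (add_monoid W) h"
    unfolding tensor_rels_def
  proof (simp, rule Rel.generate_subgroup_incl[OF _ h.subgroup_kernel], rule subsetI, elim UnE CollectE exE conjE, goal_cases)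
    case (1 z x y c)
    have "h z = \<zero>\<^bsub>W\<^esub>"
      unfolding 1(1)
      by (rule h_cancel) (use 1 pi_closed in \<open>auto simp: h_of pi_mult W.smult_r_distr\<close>)
    then show ?case using 1 by (auto simp: kernel_def dest!: subsetD[OF keys_diff])
  next
    case (2 z x c d)
    have "h z = \<zero>\<^bsub>W\<^esub>"
      unfolding 2(2)
      by (rule h_cancel) (use 2 pi_closed W.smult_l_distr[of c d] in \<open>auto simp: h_of\<close>)
    then show ?case using 2 by (auto simp: kernel_def dest!: subsetD[OF keys_diff])
  qed
  with Rel.normal_axioms obtain f where "f \<in> hom (F Mod R) (add_monoid W)"
    and f: "\<And>x. x \<in> carrier F \<Longrightarrow> f (R #>\<^bsub>F\<^esub> x) = h x"
    by (rule h.FactGroup_universal_kernel) blast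
  moreover have "f (R #>\<^bsub>F\<^esub> frag_of (x, c)) = c \<odot>\<^bsub>W\<^esub> \<pi> x" if "x \<in> carrier T" for x c
    using f[of "frag_of (x, c)"] that h_of by simp
  ultimately show ?thesis using that by blast
qed

lemma Fp_tensor_carrierE:
  assumes "X \<in> carrier (Fp_tensor TYPE('p) T)"
  obtains t where "t \<in> carrier T" "X = R #>\<^bsub>F\<^esub> frag_of (t, 1)"
proof -
  obtain x where x: "x \<in> carrier F" "X = R #>\<^bsub>F\<^esub> x"
    using assms by (auto simp: Fp_tensor_def tensor_def carrier_FactGroup)
  obtain t where "t \<in> carrier T" "x - frag_of (t, 1) \<in> R"
    using coset_representative[of x] x(1) by auto
  then show ?thesis using that[of t] x R_coset_eq[of x "frag_of (t, 1)"] by simp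
qed

lemma coset_in_Fp_tensor:
  "x \<in> carrier F \<Longrightarrow> R #>\<^bsub>F\<^esub> x \<in> carrier (Fp_tensor TYPE('p) T)"
  by (auto simp: Fp_tensor_def tensor_def carrier_FactGroup)

lemma tensor_map_frag_of:
  assumes "g \<in> hom T T" "h \<in> hom (Fp_group TYPE('p)) (Fp_group TYPE('p))" "t \<in> carrier T"
  shows "tensor_map T (Fp_group TYPE('p)) g h (R #>\<^bsub>F\<^esub> frag_of (t, c)) = R #>\<^bsub>F\<^esub> frag_of (g t, h c)"
  using tensor_map_coset[OF T.group_axioms group_Fp_group assms(1,2), of "frag_of (t, c)"] assms(3)
  by simp

lemma smult_frag_of:
  assumes "t \<in> carrier T"
  shows "c \<odot>\<^bsub>Fp_tensor TYPE('p) T\<^esub> (R #>\<^bsub>F\<^esub> frag_of (t, d)) = R #>\<^bsub>F\<^esub> frag_of (t, c * d)"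
  using tensor_map_frag_of[of "\<lambda>x. x" "\<lambda>z. c * z" t d] assms
  by (simp add: Fp_tensor_def hom_def distrib_left)

lemma tensor_map_closed:
  assumes "g \<in> hom T T" "X \<in> carrier (Fp_tensor TYPE('p) T)"
  shows "tensor_map T (Fp_group TYPE('p)) g (\<lambda>z. z) X \<in> carrier (Fp_tensor TYPE('p) T)"
proof -
  obtain t where "t \<in> carrier T" "X = R #>\<^bsub>F\<^esub> frag_of (t, 1)"
    using Fp_tensor_carrierE[OF assms(2)] .
  then show ?thesis
    using tensor_map_frag_of[of g "\<lambda>z. z" t 1] assms(1) coset_in_Fp_tensor[of "frag_of (g t, 1)"]
    by (simp add: hom_def Pi_iff)
qed

lemma smult_closed:
  assumes "X \<in> carrier (Fp_tensor TYPE('p) T)"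
  shows "c \<odot>\<^bsub>Fp_tensor TYPE('p) T\<^esub> X \<in> carrier (Fp_tensor TYPE('p) T)"
proof -
  obtain t where "t \<in> carrier T" "X = R #>\<^bsub>F\<^esub> frag_of (t, 1)"
    using Fp_tensor_carrierE[OF assms] .
  then show ?thesis
    using smult_frag_of[of t c 1] coset_in_Fp_tensor[of "frag_of (t, c)"] by simp
qed

lemma add_closed:
  assumes "X \<in> carrier (Fp_tensor TYPE('p) T)" "Y \<in> carrier (Fp_tensor TYPE('p) T)"
  shows "X \<oplus>\<^bsub>Fp_tensor TYPE('p) T\<^esub> Y \<in> carrier (Fp_tensor TYPE('p) T)"
  using Rel.factorgroup_is_group[THEN group.is_monoid, THEN monoid.m_closed, of X Y] assms
  by (simp add: Fp_tensor_def tensor_def)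

text \<open>Linearity, injectivity and equivariance need to be tested only on representatives t (x)
  1, where the induced map is \<open>\<pi>\<close> itself.\<close>

lemma FpG_isomorphic_Fp_tensor:
  assumes \<phi>: "\<phi> \<in> hom T T" and equiv: "\<And>x. x \<in> carrier T \<Longrightarrow> \<pi> (\<phi> x) = \<psi> (\<pi> x)"
  shows "FpG_isomorphic (Fp_tensor TYPE('p) T) (tensor_map T (Fp_group TYPE('p)) \<phi> (\<lambda>z. z)) W \<psi>"
proof -
  let ?V = "Fp_tensor TYPE('p) T"
  obtain f where f: "f \<in> hom (F Mod R) (add_monoid W)"
    and f_of: "\<And>x c. x \<in> carrier T \<Longrightarrow> f (R #>\<^bsub>F\<^esub> frag_of (x, c)) = c \<odot>\<^bsub>W\<^esub> \<pi> x"
    using ex_coset_map by blast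
  have V: "carrier ?V = carrier (F Mod R)" "add ?V = monoid.mult (F Mod R)"
    by (simp_all add: Fp_tensor_def tensor_def)
  have f1: "f (R #>\<^bsub>F\<^esub> frag_of (x, 1)) = \<pi> x" if "x \<in> carrier T" for x
    using f_of[of x 1] W.smult_one[of "\<pi> x"] pi_closed[OF that] that by simp
  have \<phi>T: "\<phi> x \<in> carrier T" if "x \<in> carrier T" for x using \<phi> that by (auto simp: hom_def)
  have "f \<in> LinearCombinations.module_hom class_ring ?V W"
    unfolding LinearCombinations.module_hom_def
  proof (intro CollectI conjI allI impI; (elim conjE)?)
    show "f \<in> carrier ?V \<rightarrow> carrier W" using f unfolding V by (auto simp: hom_def)
  next
    fix X Y assume "X \<in> carrier ?V" "Y \<in> carrier ?V"
    then show "f (X \<oplus>\<^bsub>?V\<^esub> Y) = f X \<oplus>\<^bsub>W\<^esub> f Y" using hom_mult[OF f, of X Y] unfolding V by simp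
  next
    fix c X assume "X \<in> carrier ?V"
    then obtain t where "t \<in> carrier T" "X = R #>\<^bsub>F\<^esub> frag_of (t, 1)" by (rule Fp_tensor_carrierE)
    then show "f (c \<odot>\<^bsub>?V\<^esub> X) = c \<odot>\<^bsub>W\<^esub> f X" using smult_frag_of[of t c 1] f_of[of t c] f1[of t] by simp
  qed
  moreover have "bij_betw f (carrier ?V) (carrier W)"
    unfolding bij_betw_def
  proof (intro conjI inj_onI)
    fix X Y assume X: "X \<in> carrier ?V" and Y: "Y \<in> carrier ?V" and eq: "f X = f Y"
    obtain t where t: "t \<in> carrier T" "X = R #>\<^bsub>F\<^esub> frag_of (t, 1)" using X by (rule Fp_tensor_carrierE)
    obtain u where u: "u \<in> carrier T" "Y = R #>\<^bsub>F\<^esub> frag_of (u, 1)" using Y by (rule Fp_tensor_carrierE)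
    have "\<pi> t = \<pi> u" using t u eq f1 by simp
    then show "X = Y"
      using pi_eq_imp_coset_eq[OF t(1) u(1)] t u R_coset_eq[of "frag_of (t, 1)" "frag_of (u, 1)"] by simp
  next
    show "f ` carrier ?V = carrier W"
    proof
      show "f ` carrier ?V \<subseteq> carrier W" using f unfolding V by (auto simp: hom_def)
      show "carrier W \<subseteq> f ` carrier ?V"
      proof
        fix w assume "w \<in> carrier W"
        then obtain x where "x \<in> carrier T" "w = \<pi> x" using surj by blast
        then show "w \<in> f ` carrier ?V"
          using f1 coset_in_Fp_tensor[of "frag_of (x, 1)"] by (intro image_eqI[of _ _ "R #>\<^bsub>F\<^esub> frag_of (x, 1)"]) auto
      qed
    qed
  qed
  moreover have "f (tensor_map T (Fp_group TYPE('p)) \<phi> (\<lambda>z. z) X) = \<psi> (f X)" if X: "X \<in> carrier ?V" for X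
  proof -
    obtain t where t: "t \<in> carrier T" "X = R #>\<^bsub>F\<^esub> frag_of (t, 1)"
      using X by (rule Fp_tensor_carrierE)
    then show ?thesis
      using tensor_map_frag_of[OF \<phi>, of "\<lambda>z. z" t 1] equiv[of t] f1 \<phi>T by (simp add: hom_def)
  qed
  ultimately show ?thesis unfolding FpG_isomorphic_def by blast
qed

end


section \<open>Uniqueness of the Jordan multiplicities\<close>

lemma finite_jordan_idx: "finite (jordan_idx p l)"
  by (simp add: jordan_idx_def)

lemma jordan_sum_simps:
  fixes l :: "nat \<Rightarrow> nat"
  defines "W \<equiv> jordan_sum l :: ('p::prime_card mod_ring, _) module"
  shows "carrier W = (\<Pi>\<^sub>E i\<in>jordan_idx CARD('p) l. carrier_vec (fst i))"
    "\<zero>\<^bsub>W\<^esub> = (\<lambda>i\<in>jordan_idx CARD('p) l. 0\<^sub>v (fst i))"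
    "v \<oplus>\<^bsub>W\<^esub> w = (\<lambda>i\<in>jordan_idx CARD('p) l. v i + w i)"
    "c \<odot>\<^bsub>W\<^esub> v = (\<lambda>i\<in>jordan_idx CARD('p) l. c \<cdot>\<^sub>v v i)"
  by (simp_all add: W_def jordan_sum_def Let_def module_vec_simps cong: PiE_cong)

lemma module_jordan_sum:
  "module class_ring (jordan_sum l :: ('p::prime_card mod_ring, _) module)"
proof (rule moduleI)
  show "cring (class_ring :: 'p mod_ring ring)" by (rule class_cring.cring_axioms)
next
  show "abelian_group (jordan_sum l :: ('p mod_ring, _) module)"
  proof (rule abelian_groupI)
    fix x y z :: "nat \<times> nat \<Rightarrow> 'p mod_ring vec"
    let ?I = "jordan_idx CARD('p) l" and ?W = "jordan_sum l :: ('p mod_ring, _) module"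
    assume x: "x \<in> carrier ?W"
    have x_closed: "x i \<in> carrier_vec (fst i)" if "i \<in> ?I" for i
      using x that by (auto simp: jordan_sum_simps)
    show "\<zero>\<^bsub>?W\<^esub> \<oplus>\<^bsub>?W\<^esub> x = x"
      using x by (auto simp: jordan_sum_simps PiE_iff extensional_def fun_eq_iff)
    show "\<exists>y\<in>carrier ?W. y \<oplus>\<^bsub>?W\<^esub> x = \<zero>\<^bsub>?W\<^esub>"
      using x_closed
      by (intro bexI[of _ "\<lambda>i\<in>?I. - x i"]) (auto simp: jordan_sum_simps uminus_l_inv_vec)
    assume y: "y \<in> carrier ?W"
    have y_closed: "y i \<in> carrier_vec (fst i)" if "i \<in> ?I" for i
      using y that by (auto simp: jordan_sum_simps)
    show "x \<oplus>\<^bsub>?W\<^esub> y \<in> carrier ?W"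
      using x_closed y_closed by (auto simp: jordan_sum_simps)
    show "x \<oplus>\<^bsub>?W\<^esub> y = y \<oplus>\<^bsub>?W\<^esub> x"
      unfolding jordan_sum_simps by (intro restrict_ext comm_add_vec[OF x_closed y_closed])
    assume z: "z \<in> carrier ?W"
    have z_closed: "z i \<in> carrier_vec (fst i)" if "i \<in> ?I" for i
      using z that by (auto simp: jordan_sum_simps)
    show "x \<oplus>\<^bsub>?W\<^esub> y \<oplus>\<^bsub>?W\<^esub> z = x \<oplus>\<^bsub>?W\<^esub> (y \<oplus>\<^bsub>?W\<^esub> z)"
      by (auto simp: jordan_sum_simps intro!: restrict_ext assoc_add_vec[OF x_closed y_closed z_closed])
  qed (auto simp: jordan_sum_simps)
qed (auto simp: jordan_sum_simps fun_eq_iff PiE_iff add_smult_distrib_vec smult_smult_assoc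
     intro!: smult_add_distrib_vec[of _ "fst _"] restrict_ext simp: extensional_def)

section \<open>Kernels of the powers of \<phi> - 1 and the block sizes\<close>

lemma jordan_block_mult_vec:
  assumes "v \<in> carrier_vec q" "j < q"
  shows "(jordan_block q 1 *\<^sub>v v) $ j = v $ j + (if Suc j < q then v $ Suc j else (0 :: 'a :: comm_ring_1))"
proof -
  have "(jordan_block q 1 *\<^sub>v v) $ j = (\<Sum>i<q. (if j = i then 1 else if Suc j = i then 1 else 0) * v $ i)"
    using assms by (simp add: scalar_prod_def atLeast0LessThan)
  also have "\<dots> = (\<Sum>i<q. (if i = j then v $ i else 0) + (if i = Suc j then v $ i else 0))"
    by (intro sum.cong) auto
  also have "\<dots> = v $ j + (if Suc j < q then v $ Suc j else 0)"
    using assms by (simp add: sum.distrib)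
  finally show ?thesis .
qed

text \<open>The operator \<phi> - 1, expressed through addition and scalars alone, so that linear
  equivariant maps commute with it directly.\<close>

definition unipotent_part :: "('p::prime_card mod_ring, 'v) module \<Rightarrow> ('v \<Rightarrow> 'v) \<Rightarrow> 'v \<Rightarrow> 'v" where
  "unipotent_part V \<phi> v = \<phi> v \<oplus>\<^bsub>V\<^esub> (- 1) \<odot>\<^bsub>V\<^esub> v"

text \<open>Writing \<open>0 \<odot> v\<close> for the zero vector spares a proof that the tensor product is a module.\<close>

definition unipotent_kernel ::
  "('p::prime_card mod_ring, 'v) module \<Rightarrow> ('v \<Rightarrow> 'v) \<Rightarrow> nat \<Rightarrow> 'v set" where
  "unipotent_kernel V \<phi> k = {v \<in> carrier V. (unipotent_part V \<phi> ^^ k) v = 0 \<odot>\<^bsub>V\<^esub> v}"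

text \<open>Closure of \<open>carrier V\<close> under the three operations keeps all iterates of
  \<phi> - 1 inside \<open>V\<close>, where the isomorphism commutes with them; it then matches the
  kernels bijectively. Counting elements takes the place of dimensions.\<close>

lemma card_unipotent_kernel_cong:
  fixes V :: "('p::prime_card mod_ring, 'v) module" and W :: "('p mod_ring, 'w) module"
  assumes iso: "FpG_isomorphic V \<phi> W \<psi>"
    and \<phi>: "\<And>v. v \<in> carrier V \<Longrightarrow> \<phi> v \<in> carrier V"
    and add: "\<And>v w. v \<in> carrier V \<Longrightarrow> w \<in> carrier V \<Longrightarrow> v \<oplus>\<^bsub>V\<^esub> w \<in> carrier V"
    and smult: "\<And>c v. v \<in> carrier V \<Longrightarrow> c \<odot>\<^bsub>V\<^esub> v \<in> carrier V"
  shows "card (unipotent_kernel V \<phi> k) = card (unipotent_kernel W \<psi> k)"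
proof -
  obtain f where f: "f \<in> LinearCombinations.module_hom class_ring V W"
    and bij: "bij_betw f (carrier V) (carrier W)" and equiv: "\<And>v. v \<in> carrier V \<Longrightarrow> f (\<phi> v) = \<psi> (f v)"
    using iso unfolding FpG_isomorphic_def by blast
  have f_add: "f (v \<oplus>\<^bsub>V\<^esub> w) = f v \<oplus>\<^bsub>W\<^esub> f w" if "v \<in> carrier V" "w \<in> carrier V" for v w
    using f that unfolding LinearCombinations.module_hom_def by blast
  have f_smult: "f (c \<odot>\<^bsub>V\<^esub> v) = c \<odot>\<^bsub>W\<^esub> f v" if "v \<in> carrier V" for c v
    using f that unfolding LinearCombinations.module_hom_def by simp
  have pow: "(unipotent_part V \<phi> ^^ k) v \<in> carrier V \<and>
    f ((unipotent_part V \<phi> ^^ k) v) = (unipotent_part W \<psi> ^^ k) (f v)" if "v \<in> carrier V" for v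
    by (induction k) (auto simp: that unipotent_part_def \<phi> add smult f_add f_smult equiv)
  have "(unipotent_part V \<phi> ^^ k) v = 0 \<odot>\<^bsub>V\<^esub> v \<longleftrightarrow> (unipotent_part W \<psi> ^^ k) (f v) = 0 \<odot>\<^bsub>W\<^esub> f v"
    if v: "v \<in> carrier V" for v
    using pow[OF v] f_smult[OF v, of 0] smult[OF v, of 0] bij_betw_imp_inj_on[OF bij] by (metis inj_onD)
  then have "f ` unipotent_kernel V \<phi> k = unipotent_kernel W \<psi> k"
    unfolding unipotent_kernel_def bij_betw_imp_surj_on[OF bij, symmetric] by auto
  moreover have "inj_on f (unipotent_kernel V \<phi> k)"
    using bij by (auto simp: bij_betw_def unipotent_kernel_def intro: inj_on_subset)
  ultimately show ?thesis using card_image by metis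
qed

text \<open>Removing the diagonal from a Jordan block leaves the shift of entries towards index
  0.\<close>

lemma unipotent_part_jordan_sum:
  fixes v :: "nat \<times> nat \<Rightarrow> 'p::prime_card mod_ring vec"
  assumes v: "v \<in> carrier (jordan_sum l)"
  shows "unipotent_part (jordan_sum l) (jordan_sum_act l) v =
    (\<lambda>i\<in>jordan_idx CARD('p) l. vec (fst i) (\<lambda>j. if Suc j < fst i then v i $ Suc j else 0))"
  unfolding unipotent_part_def jordan_sum_simps jordan_sum_act_def
proof (rule restrict_ext)
  fix i assume i: "i \<in> jordan_idx CARD('p) l"
  have "v i \<in> carrier_vec (fst i)" using v i by (auto simp: jordan_sum_simps)
  with i show "(\<lambda>i\<in>jordan_idx CARD('p) l. jordan_block (fst i) 1 *\<^sub>v v i) i +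
      (\<lambda>i\<in>jordan_idx CARD('p) l. - 1 \<cdot>\<^sub>v v i) i = vec (fst i) (\<lambda>j. if Suc j < fst i then v i $ Suc j else 0)"
    by (intro eq_vecI) (auto simp del: index_mult_mat_vec simp: jordan_block_mult_vec dim_mult_mat_vec)
qed

lemma unipotent_part_jordan_sum_pow:
  fixes v :: "nat \<times> nat \<Rightarrow> 'p::prime_card mod_ring vec"
  assumes v: "v \<in> carrier (jordan_sum l)"
  shows "(unipotent_part (jordan_sum l) (jordan_sum_act l) ^^ k) v =
    (\<lambda>i\<in>jordan_idx CARD('p) l. vec (fst i) (\<lambda>j. if j + k < fst i then v i $ (j + k) else 0))"
proof (induction k)
  case 0
  show ?case
  proof
    fix i
    show "(unipotent_part (jordan_sum l) (jordan_sum_act l) ^^ 0) v i =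
      (\<lambda>i\<in>jordan_idx CARD('p) l. vec (fst i) (\<lambda>j. if j + 0 < fst i then v i $ (j + 0) else 0)) i"
      using v PiE_arb[OF v[unfolded jordan_sum_simps], of i]
      by (cases "i \<in> jordan_idx CARD('p) l") (auto simp: jordan_sum_simps PiE_iff)
  qed
next
  case (Suc k)
  show ?case
    unfolding funpow.simps comp_def Suc
    by (subst unipotent_part_jordan_sum) (auto simp: jordan_sum_simps intro!: restrict_ext eq_vecI)
qed

text \<open>These vectors form the kernel of the k-th power of the shift on one block; exactly the
  first min k q entries are free.\<close>

lemma card_vec_prefix:
  "card {x \<in> carrier_vec q. \<forall>j<q. k \<le> j \<longrightarrow> x $ j = (0 :: 'p::prime_card mod_ring)} = CARD('p) ^ min k q"
proof -
  have "bij_betw (\<lambda>f. vec q (\<lambda>j. if j < k then f j else 0)) ({..<min k q} \<rightarrow>\<^sub>E (UNIV :: 'p mod_ring set))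
    {x \<in> carrier_vec q. \<forall>j<q. k \<le> j \<longrightarrow> x $ j = 0}"
    by (rule bij_betwI[where g = "\<lambda>x. \<lambda>j\<in>{..<min k q}. x $ j"])
       (auto simp: PiE_iff extensional_def fun_eq_iff)
  then have "card {x \<in> carrier_vec q. \<forall>j<q. k \<le> j \<longrightarrow> x $ j = (0 :: 'p mod_ring)} 
    = card ({..<min k q} \<rightarrow>\<^sub>E (UNIV :: 'p mod_ring set))"
    by (simp add: bij_betw_same_card)
  then show ?thesis by (simp add: card_PiE)
qed

lemma card_unipotent_kernel_jordan_sum:
  "card (unipotent_kernel (jordan_sum l :: ('p::prime_card mod_ring, _) module) (jordan_sum_act l) k) =
    CARD('p) ^ (\<Sum>i\<in>jordan_idx CARD('p) l. min k (fst i))"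
proof -
  let ?I = "jordan_idx CARD('p) l" and ?W = "jordan_sum l :: ('p mod_ring, _) module"
  have "v \<in> unipotent_kernel ?W (jordan_sum_act l) k \<longleftrightarrow>
    v \<in> (\<Pi>\<^sub>E i\<in>?I. {x \<in> carrier_vec (fst i). \<forall>j<fst i. k \<le> j \<longrightarrow> x $ j = 0})" for v
  proof (cases "v \<in> carrier ?W")
    case True
    \<comment> \<open>Re-indexing by k: the entries read off by the k-fold shift are those at
      positions k and beyond.\<close>
    have shift: "(\<forall>j<q. (if j + k < q then x $ (j + k) else 0) = 0) \<longleftrightarrow> (\<forall>j<q. k \<le> j \<longrightarrow> x $ j = (0 :: 'p mod_ring))" for q x
      by (metis add_diff_inverse_nat less_imp_diff_less not_less add.commute le_add2)
    have zero: "vec q g = 0 \<cdot>\<^sub>v x \<longleftrightarrow> (\<forall>j<q. g j = 0)" if "x \<in> carrier_vec q" for q g and x :: "'p mod_ring vec"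
      using that by (auto simp: vec_eq_iff)
    have "v \<in> unipotent_kernel ?W (jordan_sum_act l) k \<longleftrightarrow>
      (\<forall>i\<in>?I. vec (fst i) (\<lambda>j. if j + k < fst i then v i $ (j + k) else 0) = 0 \<cdot>\<^sub>v v i)"
      using True unfolding unipotent_kernel_def mem_Collect_eq unipotent_part_jordan_sum_pow[OF True]
      by (auto simp: jordan_sum_simps(4) restrict_def fun_eq_iff)
    also have "\<dots> \<longleftrightarrow> (\<forall>i\<in>?I. \<forall>j<fst i. (if j + k < fst i then v i $ (j + k) else 0) = 0)"
      using True by (intro ball_cong refl zero) (auto simp: jordan_sum_simps)
    also have "\<dots> \<longleftrightarrow> (\<forall>i\<in>?I. \<forall>j<fst i. k \<le> j \<longrightarrow> v i $ j = 0)"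
      unfolding shift ..
    finally show ?thesis using True by (auto simp: jordan_sum_simps PiE_iff)
  next
    case False
    then show ?thesis by (auto simp: unipotent_kernel_def jordan_sum_simps PiE_iff)
  qed
  then have "unipotent_kernel ?W (jordan_sum_act l) k =
    (\<Pi>\<^sub>E i\<in>?I. {x \<in> carrier_vec (fst i). \<forall>j<fst i. k \<le> j \<longrightarrow> x $ j = 0})" by blast
  then show ?thesis
    by (simp add: card_PiE finite_jordan_idx card_vec_prefix power_sum)
qed

lemma sum_jordan_idx: "(\<Sum>i\<in>jordan_idx p l. f (fst i)) = (\<Sum>q=1..p. l q * f q)" for f :: "nat \<Rightarrow> nat"
proof -
  have "(\<Sum>i\<in>jordan_idx p l. f (fst i)) = (\<Sum>(q, j)\<in>jordan_idx p l. f q)"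
    by (simp add: case_prod_unfold)
  then show ?thesis
    unfolding jordan_idx_def by (subst (asm) sum.Sigma[symmetric]) auto
qed

text \<open>Applied to the reduction of T, this is the order of T / pT, from which the rank is
  recovered.\<close>

lemma card_jordan_sum:
  "card (carrier (jordan_sum l :: ('p::prime_card mod_ring, _) module)) = CARD('p) ^ (\<Sum>q=1..CARD('p). l q * q)"
proof -
  have "card (carrier_vec q :: 'p mod_ring vec set) = CARD('p) ^ q" for q
  proof -
    have "{x \<in> carrier_vec q. \<forall>j<q. q \<le> j \<longrightarrow> x $ j = (0 :: 'p mod_ring)} = carrier_vec q" by auto
    then show ?thesis using card_vec_prefix[of q q, where 'p='p] by simp
  qed
  then show ?thesis
    unfolding sum_jordan_idx[of "\<lambda>q. q", symmetric]
    by (simp add: jordan_sum_simps card_PiE finite_jordan_idx power_sum)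
qed

text \<open>As a function of k, min k n has a single kink, at k = n. The negated second difference
  at q of the sum therefore counts the blocks of size exactly q; q >= 1 makes q - 1 a genuine
  predecessor.\<close>

lemma jordan_idx_multiplicity_unique:
  assumes eq: "\<And>k. (\<Sum>i\<in>jordan_idx p l. min k (fst i)) = (\<Sum>i\<in>jordan_idx p l'. min k (fst i))"
    and q: "1 \<le> q" "q \<le> p"
  shows "l q = l' q"
proof -
  have *: "2 * int (min q (n :: nat)) - int (min (q - 1) n) - int (min (q + 1) n) = (if n = q then 1 else 0)" for n
    using q by auto
  have "int (m q) = 2 * int (\<Sum>i\<in>jordan_idx p m. min q (fst i)) - int (\<Sum>i\<in>jordan_idx p m. min (q - 1) (fst i))
     - int (\<Sum>i\<in>jordan_idx p m. min (q + 1) (fst i))" for m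
  proof -
    have "2 * int (\<Sum>i\<in>jordan_idx p m. min q (fst i)) - int (\<Sum>i\<in>jordan_idx p m. min (q - 1) (fst i))
     - int (\<Sum>i\<in>jordan_idx p m. min (q + 1) (fst i)) =
      (\<Sum>n=1..p. int (m n) * (2 * int (min q n) - int (min (q - 1) n) - int (min (q + 1) n)))"
      unfolding sum_jordan_idx[of "\<lambda>n. min _ n"]
      by (simp add: sum_subtractf sum_distrib_left right_diff_distrib mult.left_commute)
    also have "\<dots> = int (m q)"
      unfolding * using q by (simp add: if_distrib[of "\<lambda>x. _ * x"] cong: if_cong)
    finally show ?thesis by simp
  qed
  from this[of l] this[of l'] show ?thesis by (simp add: eq)
qed

context mod_p_reduction
begin

lemma card_carrier_Fp_tensor: "card (carrier (Fp_tensor TYPE('p) T)) = card (carrier W)"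
  \<comment> \<open>Only the underlying bijection matters here, so both actions are taken to be the
    identity.\<close>
  using FpG_isomorphic_Fp_tensor[of "\<lambda>x. x" "\<lambda>x. x"]
  by (auto simp: FpG_isomorphic_def hom_def bij_betw_same_card)

end

text \<open>The reduction supplies a witness for the definite description. Any other Jordan sum
  isomorphic to the tensor product has kernels of the same orders, and comparing exponents of p
  gives uniqueness.\<close>

lemma ell_eq:
  fixes l :: "nat \<Rightarrow> nat"
  assumes red: "mod_p_reduction T (jordan_sum l :: ('p::prime_card mod_ring, _) module) \<pi>"
    and \<phi>: "\<phi> \<in> hom T T"
    and equiv: "\<And>x. x \<in> carrier T \<Longrightarrow> \<pi> (\<phi> x) = jordan_sum_act l (\<pi> x)"
    and q: "1 \<le> q" "q \<le> CARD('p)"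
  shows "ell TYPE('p) T \<phi> q = l q"
proof -
  interpret mod_p_reduction T "jordan_sum l :: ('p mod_ring, _) module" \<pi> by (rule red)
  let ?V = "Fp_tensor TYPE('p) T" and ?\<phi> = "tensor_map T (Fp_group TYPE('p)) \<phi> (\<lambda>z. z)"
  have iso: "FpG_isomorphic ?V ?\<phi> (jordan_sum l) (jordan_sum_act l)"
    by (rule FpG_isomorphic_Fp_tensor[OF \<phi> equiv])
  show ?thesis unfolding ell_def jordan_mult_def
  proof (rule the_equality)
    show "\<exists>l'. FpG_isomorphic ?V ?\<phi> (jordan_sum l') (jordan_sum_act l') \<and> l q = l' q"
      using iso by blast
  next
    fix m assume "\<exists>l'. FpG_isomorphic ?V ?\<phi> (jordan_sum l') (jordan_sum_act l') \<and> m = l' q"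
    then obtain l' where iso': "FpG_isomorphic ?V ?\<phi> (jordan_sum l') (jordan_sum_act l')" and m: "m = l' q"
      by blast
    have "card (unipotent_kernel ?V ?\<phi> k) = CARD('p) ^ (\<Sum>i\<in>jordan_idx CARD('p) l''. min k (fst i))"
      if "FpG_isomorphic ?V ?\<phi> (jordan_sum l'') (jordan_sum_act l'')" for l'' k
      unfolding card_unipotent_kernel_jordan_sum[symmetric]
      by (rule card_unipotent_kernel_cong[OF that]) (auto intro: tensor_map_closed[OF \<phi>] smult_closed add_closed)
    from this[OF iso] this[OF iso']
    have "CARD('p) ^ (\<Sum>i\<in>jordan_idx CARD('p) l'. min k (fst i)) =
      CARD('p) ^ (\<Sum>i\<in>jordan_idx CARD('p) l. min k (fst i))" for k by metis
    then have "(\<Sum>i\<in>jordan_idx CARD('p) l'. min k (fst i)) = (\<Sum>i\<in>jordan_idx CARD('p) l. min k (fst i))" for k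
      using prime_gt_1_nat[OF prime_card[where 'a='p]] by simp
    from jordan_idx_multiplicity_unique[OF this q] show "m = l q" by (simp add: m)
  qed
qed


section \<open>Ideals of \<open>\<int>[\<xi>]\<close> modulo powers of \<open>\<xi> - 1\<close>\<close>

lemma of_int_mod_ring_eq_iff:
  "(of_int c :: 'p::prime_card mod_ring) = of_int d \<longleftrightarrow> int CARD('p) dvd c - d"
  using of_int_eq_0_iff_char_dvd[where 'a="'p mod_ring", of "c - d"] by simp

section \<open>The ring \<int>[\<xi>] and the powers of \<theta>\<close>

locale prime_cyclotomic =
  fixes \<xi> :: complex and p :: nat
  assumes prime: "prime p" and root: "primitive_root_of_unity p \<xi>"
begin

abbreviation \<O> where "\<O> \<equiv> carrier (Z_adjoin \<xi>)"
definition \<theta> where "\<theta> = \<xi> - 1"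

lemma p_gt_1: "p > 1"
  using prime by (rule prime_gt_1_nat)

lemma theta_nonzero: "\<theta> \<noteq> 0"
  using root p_gt_1 unfolding primitive_root_of_unity_def \<theta>_def by force

lemma O_iff: "x \<in> \<O> \<longleftrightarrow> (\<exists>f :: int poly. x = poly (map_poly of_int f) \<xi>)"
  by (auto simp: Z_adjoin_def)

lemma O_add: "x \<in> \<O> \<Longrightarrow> y \<in> \<O> \<Longrightarrow> x + y \<in> \<O>"
  unfolding O_iff by (metis of_int_poly_hom.hom_add poly_add)

lemma O_mult: "x \<in> \<O> \<Longrightarrow> y \<in> \<O> \<Longrightarrow> x * y \<in> \<O>"
  unfolding O_iff by (metis of_int_poly_hom.hom_mult poly_mult)

lemma O_of_int: "of_int c \<in> \<O>"
  unfolding O_iff by (rule exI[of _ "[:c:]"]) (simp add: of_int_hom.map_poly_pCons_hom)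

lemma O_xi: "\<xi> \<in> \<O>"
  unfolding O_iff by (rule exI[of _ "[:0, 1:]"]) simp

lemma O_uminus: "x \<in> \<O> \<Longrightarrow> - x \<in> \<O>"
  using O_mult[OF O_of_int[of "-1"], of x] by simp

lemma O_diff: "x \<in> \<O> \<Longrightarrow> y \<in> \<O> \<Longrightarrow> x - y \<in> \<O>"
  using O_add[OF _ O_uminus] by fastforce

lemma O_one: "1 \<in> \<O>" and O_zero: "0 \<in> \<O>" and O_of_nat: "of_nat n \<in> \<O>"
  using O_of_int[of 1] O_of_int[of 0] O_of_int[of "int n"] by simp_all

lemma O_theta: "\<theta> \<in> \<O>"
  unfolding \<theta>_def by (intro O_diff O_xi O_one)

lemma O_power: "x \<in> \<O> \<Longrightarrow> x ^ n \<in> \<O>"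
  by (induction n) (auto intro: O_one O_mult)

lemma O_sum: "(\<And>i. i \<in> I \<Longrightarrow> f i \<in> \<O>) \<Longrightarrow> sum f I \<in> \<O>"
  by (induction I rule: infinite_finite_induct) (auto intro: O_zero O_add)

text \<open>Because \<xi> = 1 + \<theta>, a polynomial in \<xi> is congruent modulo \<theta> to its
  integer value at 1; the induction is Horner's scheme.\<close>

lemma O_mod_theta:
  assumes "x \<in> \<O>" shows "\<exists>c::int. \<exists>y\<in>\<O>. x = of_int c + \<theta> * y"
proof -
  obtain f :: "int poly" where "x = poly (map_poly of_int f) \<xi>" using assms O_iff by blast
  then show ?thesis
  proof (induction f arbitrary: x)
    case 0
    then show ?case using O_zero by (intro exI[of _ 0] bexI[of _ 0]) auto
  next
    case (pCons b f)
    obtain c y where y: "y \<in> \<O>" "poly (map_poly of_int f) \<xi> = of_int c + \<theta> * y"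
      using pCons.IH by blast
    have "x = of_int b + \<xi> * (of_int c + \<theta> * y)"
      using pCons.prems pCons.hyps unfolding y(2)[symmetric] by (simp add: of_int_hom.map_poly_pCons_hom)
    also have "\<dots> = of_int (b + c) + \<theta> * (of_int c + \<xi> * y)"
      by (simp add: \<theta>_def algebra_simps)
    finally have "x = of_int (b + c) + \<theta> * (of_int c + \<xi> * y)" .
    then show ?case using O_add[OF O_of_int O_mult[OF O_xi y(1)]] by blast
  qed
qed

text \<open>Expand (1 + \<theta>)^p = 1, cancel the constant 1 and one factor \<theta>. Every
  binomial coefficient left beside \<theta>^(p-1) is divisible by p.\<close>

lemma theta_power_eq:
  obtains g where "g \<in> \<O>" "\<theta> ^ (p - 1) = - of_nat p * (1 + \<theta> * g)"
proof -
  define n where "n = p - 2"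
  have n: "p = Suc (Suc n)" using p_gt_1 unfolding n_def by linarith
  have "p dvd p choose k" if "1 \<le> k" "k < p" for k
    using dvd_choose_prime[OF that(2) _ _ prime] that p_gt_1 by auto
  then obtain d where d: "\<And>k. 1 \<le> k \<Longrightarrow> k < p \<Longrightarrow> p choose k = p * d k"
    unfolding dvd_def by metis
  have d1: "d 1 = 1" using d[of 1] p_gt_1 by simp
  have "1 = (\<theta> + 1) ^ p" using root by (simp add: primitive_root_of_unity_def \<theta>_def)
  also have "\<dots> = (\<Sum>k\<le>p. of_nat (p choose k) * \<theta> ^ k)"
    by (simp add: binomial_ring)
  also have "\<dots> = 1 + (\<Sum>k\<le>Suc n. of_nat (p choose Suc k) * \<theta> ^ Suc k)"
    unfolding n by (subst sum.atMost_Suc_shift) simp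
  also have "(\<Sum>k\<le>Suc n. of_nat (p choose Suc k) * \<theta> ^ Suc k) =
      \<theta> * ((\<Sum>k\<le>n. of_nat (p choose Suc k) * \<theta> ^ k) + \<theta> ^ Suc n)"
    by (simp add: n binomial_eq_0 sum_distrib_left algebra_simps)
  finally have "(\<Sum>k\<le>n. of_nat (p choose Suc k) * \<theta> ^ k) + \<theta> ^ Suc n = 0"
    using theta_nonzero by simp
  then have "\<theta> ^ Suc n = - (\<Sum>k\<le>n. of_nat (p choose Suc k) * \<theta> ^ k)"
    by (simp add: eq_neg_iff_add_eq_0 add.commute)
  also have "\<dots> = - (\<Sum>k\<le>n. of_nat p * (of_nat (d (Suc k)) * \<theta> ^ k))"
  proof -
    have "of_nat (p choose Suc k) * \<theta> ^ k = of_nat p * (of_nat (d (Suc k)) * \<theta> ^ k)" if "k \<le> n" for k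
    proof -
      have "p choose Suc k = p * d (Suc k)" using that n by (intro d) auto
      then show ?thesis by (simp only: of_nat_mult mult.assoc)
    qed
    then show ?thesis by (intro arg_cong[of _ _ uminus] sum.cong) auto
  qed
  also have "\<dots> = - of_nat p * (\<Sum>k\<le>n. of_nat (d (Suc k)) * \<theta> ^ k)"
    by (simp add: sum_distrib_left sum_negf)
  \<comment> \<open>Since p choose 1 is p, the digit \<open>d 1\<close> is 1; this is what makes the
    cofactor of -p congruent to 1 modulo \<theta>.\<close>
  also have "(\<Sum>k\<le>n. of_nat (d (Suc k)) * \<theta> ^ k) = 1 + \<theta> * (\<Sum>k<n. of_nat (d (Suc (Suc k))) * \<theta> ^ k)"
    using d1 by (simp add: sum.atMost_shift sum_distrib_left mult.left_commute)
  finally show ?thesis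
    by (intro that[of "\<Sum>k<n. of_nat (d (Suc (Suc k))) * \<theta> ^ k"])
       (auto simp: n intro!: O_sum O_mult O_of_nat O_power O_theta)
qed

lemma p_dvd_theta_power: "\<exists>u\<in>\<O>. \<theta> ^ (p - 1) = of_nat p * u"
proof -
  obtain g where "g \<in> \<O>" "\<theta> ^ (p - 1) = - of_nat p * (1 + \<theta> * g)" using theta_power_eq .
  then show ?thesis
    by (intro bexI[of _ "- (1 + \<theta> * g)"]) (auto intro!: O_uminus O_add O_one O_mult O_theta simp del: minus_add_distrib)
qed

text \<open>Bootstrapping: p = -\<theta>^(p-1) - p \<theta> g raises a divisor \<theta>^k of p to
  \<theta>^(k+1), as long as k + 1 does not exceed p - 1.\<close>

lemma theta_power_dvd_p:
  assumes "k \<le> p - 1" shows "\<exists>h\<in>\<O>. of_nat p = \<theta> ^ k * h"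
  using assms
proof (induction k)
  case 0
  show ?case using O_of_nat by simp
next
  case (Suc k)
  then obtain h where h: "h \<in> \<O>" "of_nat p = \<theta> ^ k * h" by auto
  obtain g where g: "g \<in> \<O>" "\<theta> ^ (p - 1) = - of_nat p * (1 + \<theta> * g)" using theta_power_eq .
  have "of_nat p = - (\<theta> ^ (p - 1)) - of_nat p * \<theta> * g"
    unfolding g(2) by (simp add: algebra_simps)
  also have "\<theta> ^ (p - 1) = \<theta> ^ Suc k * \<theta> ^ (p - 1 - Suc k)"
  proof -
    have "Suc k + (p - 1 - Suc k) = p - 1" using Suc.prems by linarith
    then show ?thesis by (metis power_add)
  qed
  also have "- (\<theta> ^ Suc k * \<theta> ^ (p - 1 - Suc k)) - of_nat p * \<theta> * g 
      = \<theta> ^ Suc k * (- (\<theta> ^ (p - 1 - Suc k)) - h * g)"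
    by (simp add: h(2) algebra_simps)
  finally show ?case
    by (rule bexI) (intro O_diff O_uminus O_power O_theta O_mult h g)
qed

end

text \<open>\<open>separated\<close> says that no nonzero element of \<open>A\<close> is infinitely
  divisible by p within \<open>A\<close>. It makes the valuation at \<theta> finite, and
  \<open>ideal_separated_of_free\<close> establishes it for the ideals of the decomposition.\<close>

locale cyclotomic_ideal = prime_cyclotomic +
  fixes A :: "complex set"
  assumes ideal: "ideal A (Z_adjoin \<xi>)"
    and nonzero: "A \<noteq> {0}"
    and separated: "\<And>x. x \<in> A \<Longrightarrow> (\<And>k. \<exists>y\<in>A. x = of_nat p ^ k * y) \<Longrightarrow> x = 0"
begin

abbreviation \<theta>A where "\<theta>A \<equiv> (\<lambda>x. \<theta> * x) ` A"

lemma A_subset: "x \<in> A \<Longrightarrow> x \<in> \<O>"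
  using additive_subgroup.a_Hcarr[OF ideal.axioms(1)[OF ideal]] .

lemma A_zero: "0 \<in> A"
  using additive_subgroup.zero_closed[OF ideal.axioms(1)[OF ideal]] by (simp add: Z_adjoin_def)

lemma A_add: "x \<in> A \<Longrightarrow> y \<in> A \<Longrightarrow> x + y \<in> A"
  using additive_subgroup.a_closed[OF ideal.axioms(1)[OF ideal]] by (simp add: Z_adjoin_def)

lemma A_mult: "x \<in> \<O> \<Longrightarrow> y \<in> A \<Longrightarrow> x * y \<in> A"
  using ideal.I_l_closed[OF ideal, of y x] by (simp add: Z_adjoin_def)

lemma A_uminus: "x \<in> A \<Longrightarrow> - x \<in> A"
  using A_mult[OF O_of_int[of "-1"]] by simp

lemma A_diff: "x \<in> A \<Longrightarrow> y \<in> A \<Longrightarrow> x - y \<in> A"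
  using A_add[OF _ A_uminus] by fastforce

lemma A_sum: "(\<And>i. i \<in> I \<Longrightarrow> f i \<in> A) \<Longrightarrow> sum f I \<in> A"
  by (induction I rule: infinite_finite_induct) (auto intro: A_zero A_add)

lemma thetaA_add: "x \<in> \<theta>A \<Longrightarrow> y \<in> \<theta>A \<Longrightarrow> x + y \<in> \<theta>A"
  by (auto simp: distrib_left[symmetric] intro: A_add)

lemma thetaA_mult: "x \<in> \<O> \<Longrightarrow> y \<in> \<theta>A \<Longrightarrow> x * y \<in> \<theta>A"
  by (auto simp: mult.left_commute intro: A_mult)

lemma thetaA_diff: "x \<in> \<theta>A \<Longrightarrow> y \<in> \<theta>A \<Longrightarrow> x - y \<in> \<theta>A"
  by (auto simp: right_diff_distrib[symmetric] intro: A_diff)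

lemma p_mult_eq: "k \<le> p - 1 \<Longrightarrow> y \<in> A \<Longrightarrow> \<exists>z\<in>A. of_nat p * y = \<theta> ^ k * z"
  using theta_power_dvd_p[of k] A_mult[of _ y] by (auto simp: mult.assoc)

lemma theta_power_mult_eq: "y \<in> A \<Longrightarrow> \<exists>z\<in>A. \<theta> ^ (p - 1) * y = of_nat p * z"
  using p_dvd_theta_power A_mult[of _ y] by (auto simp: mult.assoc)

lemma p_mult_thetaA: "y \<in> A \<Longrightarrow> of_nat p * y \<in> \<theta>A"
proof -
  assume "y \<in> A"
  moreover have "1 \<le> p - 1" using p_gt_1 by linarith
  ultimately show ?thesis using p_mult_eq[of 1 y] by auto
qed

text \<open>The quotient A / \<theta> A is killed by p, since p A lies in \<theta> A; so Bezout
  inverts every integer prime to p on it.\<close>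

lemma thetaA_coprime:
  assumes x: "x \<in> A" and j: "\<not> int p dvd j" and jx: "of_int j * x \<in> \<theta>A"
  shows "x \<in> \<theta>A"
proof -
  have "coprime j (int p)"
    using prime_imp_coprime[of "int p" j] prime j by (simp add: coprime_commute)
  then obtain s t where st: "s * j + t * int p = 1" 
    using bezout_int[of j "int p"] by auto
  have "x = of_int s * (of_int j * x) + of_int t * (of_nat p * x)"
    using arg_cong[OF st, of "\<lambda>n. of_int n * x"] by (simp add: algebra_simps)
  also have "\<dots> \<in> \<theta>A"
    by (intro thetaA_add thetaA_mult O_of_int jx p_mult_thetaA x)
  finally show ?thesis .
qed

text \<open>Divisibility by \<theta>^((p-1) k) within \<open>A\<close> entails divisibility by p^k,
  so separation for p passes to \<theta>.\<close>

lemma theta_separated: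
  assumes x: "x \<in> A" and div: "\<And>k. \<exists>y\<in>A. x = \<theta> ^ k * y"
  shows "x = 0"
proof (rule separated[OF x])
  fix k
  have *: "\<exists>z\<in>A. (\<theta> ^ (p - 1)) ^ k * y = of_nat p ^ k * z" if "y \<in> A" for y
    using that
  proof (induction k arbitrary: y)
    case (Suc k)
    then obtain z where z: "z \<in> A" "\<theta> ^ (p - 1) * y = of_nat p * z" using theta_power_mult_eq by blast
    obtain z' where z': "z' \<in> A" "(\<theta> ^ (p - 1)) ^ k * z = of_nat p ^ k * z'" using Suc.IH z by blast
    have "(\<theta> ^ (p - 1)) ^ Suc k * y = (\<theta> ^ (p - 1)) ^ k * (\<theta> ^ (p - 1) * y)"
      by (simp add: mult_ac)
    also have "\<dots> = of_nat p * ((\<theta> ^ (p - 1)) ^ k * z)"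
      unfolding z(2) by (simp add: mult_ac)
    also have "\<dots> = of_nat p ^ Suc k * z'"
      unfolding z'(2) by (simp add: mult_ac)
    finally show ?case using z'(1) by blast
  qed auto
  obtain y where y: "y \<in> A" "x = \<theta> ^ ((p - 1) * k) * y" using div by blast
  then show "\<exists>y\<in>A. x = of_nat p ^ k * y" using *[OF y(1)] by (simp add: power_mult)
qed

text \<open>Multiplication by a fixed nonzero b in \<open>A\<close> carries \<O> into
  \<open>A\<close> and is injective on the complex numbers, which transfers the separation.\<close>

lemma O_theta_separated:
  assumes x: "x \<in> \<O>" and div: "\<And>k. \<exists>y\<in>\<O>. x = \<theta> ^ k * y"
  shows "x = 0"
proof -
  obtain b where b: "b \<in> A" "b \<noteq> 0" using nonzero A_zero by blast
  have "x * b = 0"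
  proof (rule theta_separated)
    show "x * b \<in> A" by (rule A_mult[OF x b(1)])
    fix k
    obtain y where "y \<in> \<O>" "x = \<theta> ^ k * y" using div by blast
    then show "\<exists>z\<in>A. x * b = \<theta> ^ k * z"
      by (intro bexI[of _ "y * b"]) (auto intro: A_mult b)
  qed
  with b show ?thesis by simp
qed

section \<open>Valuation at \<theta> and generators of A / \<theta> A\<close>

lemma theta_valuation:
  assumes x: "x \<in> \<O>" "x \<noteq> 0"
  obtains m y where "y \<in> \<O>" "x = \<theta> ^ m * y" "\<And>z. z \<in> \<O> \<Longrightarrow> y \<noteq> \<theta> * z"
proof -
  define P where "P k \<longleftrightarrow> \<not> (\<exists>y\<in>\<O>. x = \<theta> ^ k * y)" for k
  have "\<exists>k. P k" using O_theta_separated[OF x(1)] x(2) unfolding P_def by blast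
  then have P: "P (LEAST k. P k)" by (rule LeastI_ex)
  \<comment> \<open>The least exponent that fails to divide x is thus a successor, and its
    predecessor m is the valuation.\<close>
  moreover have "\<not> P 0" using x unfolding P_def by simp
  ultimately obtain m where m: "(LEAST k. P k) = Suc m" by (cases "LEAST k. P k") auto
  have "\<not> P m" using not_less_Least[of m P] m by simp
  then obtain y where y: "y \<in> \<O>" "x = \<theta> ^ m * y" unfolding P_def by blast
  have "y \<noteq> \<theta> * z" if "z \<in> \<O>" for z
  proof
    assume "y = \<theta> * z"
    then have "x = \<theta> ^ Suc m * z" using y(2) by simp
    moreover have "P (Suc m)" using P m by simp
    ultimately show False using that unfolding P_def by blast
  qed
  with y show ?thesis using that by blast
qed

text \<open>Take a = \<theta>^m u of least valuation m in \<open>A\<close>. Then \<open>A\<close>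
  lies in \<theta>^m \<O>, and the residue of u modulo \<theta> is an integer prime to p, so a
  multiple of a matches any x to leading order.\<close>

lemma ex_generator_mod_thetaA:
  obtains a where "a \<in> A" "a \<notin> \<theta>A" "\<And>x. x \<in> A \<Longrightarrow> \<exists>c. x - of_int c * a \<in> \<theta>A"
proof -
  define P where "P m \<longleftrightarrow> (\<exists>x\<in>A. \<exists>y\<in>\<O>. x = \<theta> ^ m * y \<and> (\<forall>z\<in>\<O>. y \<noteq> \<theta> * z))" for m
  define m where "m = (LEAST m. P m)"
  obtain b where b: "b \<in> A" "b \<noteq> 0" using nonzero A_zero by blast
  have "\<exists>m. P m"
    using theta_valuation[OF A_subset[OF b(1)] b(2)] b(1) unfolding P_def by metis
  then have "P m" unfolding m_def by (rule LeastI_ex)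
  then obtain a u where a: "a \<in> A" "a = \<theta> ^ m * u" and u: "u \<in> \<O>" "\<And>z. z \<in> \<O> \<Longrightarrow> u \<noteq> \<theta> * z"
    unfolding P_def by blast
  have A_div: "\<exists>y\<in>\<O>. x = \<theta> ^ m * y" if x: "x \<in> A" for x
  proof (cases "x = 0")
    case True
    then show ?thesis using O_zero by (intro bexI[of _ 0]) auto
  next
    case False
    obtain k y where y: "y \<in> \<O>" "x = \<theta> ^ k * y" "\<And>z. z \<in> \<O> \<Longrightarrow> y \<noteq> \<theta> * z"
      using theta_valuation[OF A_subset[OF x] False] by metis
    then have "P k" using x unfolding P_def by blast
    then have "m \<le> k" unfolding m_def by (rule Least_le)
    then show ?thesis
      using y by (intro bexI[of _ "\<theta> ^ (k - m) * y"]) (auto simp: mult.assoc[symmetric] power_add[symmetric] intro: O_mult O_power O_theta)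
  qed
  obtain j u' where u': "u' \<in> \<O>" "u = of_int j + \<theta> * u'" using O_mod_theta[OF u(1)] by blast
  have theta_p: "\<exists>h\<in>\<O>. of_nat p = \<theta> * h" using theta_power_dvd_p[of 1] p_gt_1 by auto
  then obtain h where h: "h \<in> \<O>" "of_nat p = \<theta> * h" by blast
  \<comment> \<open>As p is a multiple of \<theta>, a residue divisible by p would make u divisible
    by \<theta>.\<close>
  have j: "\<not> int p dvd j"
  proof
    assume "int p dvd j"
    then obtain e where "j = int p * e" by (elim dvdE)
    then have "u = \<theta> * (h * of_int e + u')" using u'(2) h(2) by (simp add: algebra_simps)
    then show False using u(2)[of "h * of_int e + u'"] u' h by (auto intro: O_add O_mult O_of_int)
  qed
  then have "coprime j (int p)"
    using prime_imp_coprime[of "int p" j] prime by (simp add: coprime_commute)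
  then obtain s t where st: "s * j + t * int p = 1" 
    using bezout_int[of j "int p"] by auto
  show ?thesis
  proof (rule that[OF a(1)])
    show "a \<notin> \<theta>A"
    proof
      assume "a \<in> \<theta>A"
      then obtain b where "b \<in> A" "a = \<theta> * b" by blast
      moreover from this obtain y where "y \<in> \<O>" "b = \<theta> ^ m * y" using A_div by blast
      ultimately have "\<theta> ^ m * u = \<theta> ^ m * (\<theta> * y)" "y \<in> \<O>" using a(2) by simp_all
      then show False using u(2) theta_nonzero by simp
    qed
  next
    fix x assume x: "x \<in> A"
    obtain y where y: "y \<in> \<O>" "x = \<theta> ^ m * y" using A_div[OF x] by blast
    obtain i y' where y': "y' \<in> \<O>" "y = of_int i + \<theta> * y'" using O_mod_theta[OF y(1)] by blast
    \<comment> \<open>Modulo p, s inverts j; so c solves c j = i, the equation between the residues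
      of c u and y.\<close>
    define c where "c = i * s"
    define z where "z = of_int (i * t) * h + y' - of_int c * u'"
    have z: "z \<in> \<O>" unfolding z_def by (intro O_add O_diff O_mult O_of_int h u' y')
    have "(of_int i :: complex) = of_int i * (of_int s * of_int j + of_int t * of_nat p)"
      using arg_cong[OF st, of "of_int :: int \<Rightarrow> complex"] by simp
    also have "\<dots> = of_int c * of_int j + \<theta> * (of_int (i * t) * h)"
      unfolding h(2) c_def by (simp add: algebra_simps)
    finally have yz: "y = of_int c * u + \<theta> * z"
      unfolding y'(2) u'(2) z_def by (simp add: algebra_simps)
    define d where "d = x - of_int c * a"
    have dA: "d \<in> A" unfolding d_def by (intro A_diff x A_mult O_of_int a)
    have d: "d = \<theta> ^ Suc m * z"
      unfolding d_def y(2) a(2) yz by (simp add: algebra_simps)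
    \<comment> \<open>The difference d is so far only in \<theta>^(m+1) \<O>, which may exceed
      \<theta> A. Multiplying by u turns \<theta>^(m+1) z into \<theta> z a, which lies in \<theta>
      A; replacing u by j modulo \<theta> and cancelling j gives d itself.\<close>
    have "of_int j * d = \<theta> * (z * a) - \<theta> * (u' * d)"
    proof -
      have "(of_int j + \<theta> * u') * d = \<theta> * (z * a)"
        unfolding u'(2)[symmetric] d a(2) by (simp add: mult_ac)
      then show ?thesis by (simp add: algebra_simps)
    qed
    also have "\<dots> \<in> \<theta>A"
      by (intro thetaA_diff imageI A_mult z u' a dA)
    finally have "d \<in> \<theta>A" using thetaA_coprime[OF dA j] by blast
    then show "\<exists>c. x - of_int c * a \<in> \<theta>A" unfolding d_def by blast
  qed
qed

text \<open>A / \<theta> A is a line over F_p, so each nonzero class generates it. This admits the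
  elements a_i prescribed by the decomposition, not only those of least valuation.\<close>

lemma generator_mod_thetaA:
  assumes b: "b \<in> A" "b \<notin> \<theta>A" and x: "x \<in> A"
  shows "\<exists>c. x - of_int c * b \<in> \<theta>A"
proof -
  obtain a where a: "a \<in> A" "a \<notin> \<theta>A" "\<And>x. x \<in> A \<Longrightarrow> \<exists>c. x - of_int c * a \<in> \<theta>A"
    using ex_generator_mod_thetaA by blast
  obtain j where j: "b - of_int j * a \<in> \<theta>A" using a(3)[OF b(1)] by blast
  obtain i where i: "x - of_int i * a \<in> \<theta>A" using a(3)[OF x] by blast
  have "\<not> int p dvd j"
  proof
    assume "int p dvd j"
    then obtain e where e: "j = int p * e" by (elim dvdE)
    have "b = (b - of_int j * a) + of_int e * (of_nat p * a)" by (simp add: e)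
    also have "\<dots> \<in> \<theta>A" by (intro thetaA_add j thetaA_mult O_of_int p_mult_thetaA a)
    finally show False using b(2) by simp
  qed
  then have "coprime j (int p)"
    using prime_imp_coprime[of "int p" j] prime by (simp add: coprime_commute)
  then obtain s t where st: "s * j + t * int p = 1" 
    using bezout_int[of j "int p"] by auto
  have "of_int i * a = of_int i * (of_int s * of_int j + of_int t * of_nat p) * a"
    using arg_cong[OF st, of "of_int :: int \<Rightarrow> complex"] by simp
  then have "x - of_int (i * s) * b = (x - of_int i * a) - of_int (i * s) * (b - of_int j * a)
     + of_int (i * t) * (of_nat p * a)"
    by (simp add: algebra_simps)
  also have "\<dots> \<in> \<theta>A"
    by (intro thetaA_add thetaA_diff i j thetaA_mult O_of_int p_mult_thetaA a)
  finally show ?thesis by blast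
qed

end


section \<open>Jordan chains in \<open>A / pA\<close> and \<open>(A, a) / p(A, a)\<close>\<close>

context cyclotomic_ideal
begin

lemma theta_expansion:
  assumes a: "a \<in> A" "a \<notin> \<theta>A" and x: "x \<in> A"
  shows "\<exists>c :: nat \<Rightarrow> int. \<exists>y\<in>A. x = (\<Sum>k<m. of_int (c k) * \<theta> ^ k * a) + \<theta> ^ m * y"
proof (induction m)
  case 0
  show ?case using x by simp
next
  case (Suc m)
  then obtain c y where y: "y \<in> A" "x = (\<Sum>k<m. of_int (c k) * \<theta> ^ k * a) + \<theta> ^ m * y" by blast
  obtain d z where z: "z \<in> A" "y - of_int d * a = \<theta> * z"
    using generator_mod_thetaA[OF a y(1)] by blast
  have "(\<Sum>k<m. of_int (c k) * \<theta> ^ k * a) = (\<Sum>k<m. of_int ((c(m := d)) k) * \<theta> ^ k * a)"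
    by (intro sum.cong) auto
  moreover have "y = of_int d * a + \<theta> * z" using z(2) by (simp add: algebra_simps)
  ultimately have "x = (\<Sum>k<Suc m. of_int ((c(m := d)) k) * \<theta> ^ k * a) + \<theta> ^ Suc m * z"
    using y(2) by (simp add: algebra_simps)
  then show ?case using z(1) by blast
qed

text \<open>Uniqueness of digits modulo p, stated for a difference of expansions. The lowest digit
  is divisible by p since its multiple of a lies in \<theta> A; it is then absorbed into the
  right-hand side, and \<theta> cancels.\<close>

lemma theta_expansion_unique:
  assumes a: "a \<in> A" "a \<notin> \<theta>A" and "m \<le> p - 1" and "y \<in> A"
    and "(\<Sum>k<m. of_int (c k) * \<theta> ^ k * a) = \<theta> ^ m * y" and "k < m"
  shows "int p dvd c k"
  using assms(3-)
proof (induction m arbitrary: c y k)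
  case (Suc m)
  have shift: "(\<Sum>k<Suc m. of_int (c k) * \<theta> ^ k * a) = of_int (c 0) * a + \<theta> * (\<Sum>k<m. of_int (c (Suc k)) * \<theta> ^ k * a)"
    by (subst sum.lessThan_Suc_shift) (simp add: sum_distrib_left mult_ac)
  have SA: "(\<Sum>k<m. of_int (c (Suc k)) * \<theta> ^ k * a) \<in> A"
    by (intro A_sum A_mult O_mult O_of_int O_power O_theta a)
  have "of_int (c 0) * a = \<theta> * (\<theta> ^ m * y - (\<Sum>k<m. of_int (c (Suc k)) * \<theta> ^ k * a))"
    using Suc.prems(3) unfolding shift by (simp add: algebra_simps)
  also have "\<dots> \<in> \<theta>A"
    by (intro imageI A_diff A_mult O_power O_theta Suc.prems SA)
  finally have c0: "int p dvd c 0"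
    using thetaA_coprime[OF a(1)] a(2) by blast
  then obtain e where e: "c 0 = int p * e" by (elim dvdE)
  \<comment> \<open>The bound on the length enters here: a multiple of p can be moved to the
    remainder only up to the exponent p - 1.\<close>
  obtain z where z: "z \<in> A" "of_nat p * (of_int e * a) = \<theta> ^ Suc m * z"
    using p_mult_eq[OF Suc.prems(1) A_mult[OF O_of_int a(1)]] by blast
  have "\<theta> * (\<Sum>k<m. of_int (c (Suc k)) * \<theta> ^ k * a) = \<theta> * (\<theta> ^ m * (y - z))"
    using Suc.prems(3) z(2) unfolding shift e by (simp add: algebra_simps)
  then have "(\<Sum>k<m. of_int (c (Suc k)) * \<theta> ^ k * a) = \<theta> ^ m * (y - z)"
    using theta_nonzero by simp
  then have *: "int p dvd c (Suc k)" if "k < m" for k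
    using Suc.IH[of "y - z" "\<lambda>k. c (Suc k)" k] A_diff[OF Suc.prems(2) z(1)] Suc.prems(1) that by auto
  show ?case using c0 * Suc.prems(4) by (cases k) auto
qed simp

text \<open>Integral digits are not unique, so some are chosen; their residues modulo p do not
  depend on the choice. Stopping at p - 1 digits leaves a remainder in p A.\<close>

definition theta_coeffs :: "complex \<Rightarrow> complex \<Rightarrow> nat \<Rightarrow> int" where
  "theta_coeffs a x = (SOME c. \<exists>y\<in>A. x = (\<Sum>k<p - 1. of_int (c k) * \<theta> ^ k * a) + \<theta> ^ (p - 1) * y)"

lemma theta_coeffs:
  assumes a: "a \<in> A" "a \<notin> \<theta>A" and x: "x \<in> A"
  shows "\<exists>y\<in>A. x = (\<Sum>k<p - 1. of_int (theta_coeffs a x k) * \<theta> ^ k * a) + \<theta> ^ (p - 1) * y"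
  unfolding theta_coeffs_def by (rule someI_ex[OF theta_expansion[OF a x]])

text \<open>The chain \<open>a, \<theta>a, \<dots>\<close> is listed backwards because the Jordan blocks carry their ones on
  the superdiagonal.\<close>

definition jordan_coords :: "complex \<Rightarrow> complex \<Rightarrow> 'p::prime_card mod_ring vec" where
  "jordan_coords a x = vec (p - 1) (\<lambda>i. of_int (theta_coeffs a x (p - 2 - i)))"

context
  fixes a :: complex and ty :: "'p::prime_card itself"
  assumes card: "CARD('p) = p" and a: "a \<in> A" "a \<notin> \<theta>A"
begin

text \<open>Any expansion may be used to compute the coordinates, whatever digits
  \<open>theta_coeffs\<close> has chosen; additivity and the action are all derived from
  this.\<close>

lemma jordan_coords_eqI:
  assumes y: "y \<in> A" and x: "x = (\<Sum>k<p - 1. of_int (c k) * \<theta> ^ k * a) + \<theta> ^ (p - 1) * y"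
  shows "(jordan_coords a x :: 'p mod_ring vec) = vec (p - 1) (\<lambda>i. of_int (c (p - 2 - i)))"
proof -
  have "x \<in> A" unfolding x
    by (intro A_add A_sum A_mult O_mult O_of_int O_power O_theta a y)
  then obtain z where z: "z \<in> A" 
    "x = (\<Sum>k<p - 1. of_int (theta_coeffs a x k) * \<theta> ^ k * a) + \<theta> ^ (p - 1) * z"
    using theta_coeffs[OF a] by blast
  have "(\<Sum>k<p - 1. of_int (theta_coeffs a x k - c k) * \<theta> ^ k * a) = \<theta> ^ (p - 1) * (y - z)"
    using x z(2) by (simp add: algebra_simps sum_subtractf)
  then have "int p dvd theta_coeffs a x k - c k" if "k < p - 1" for k
    using theta_expansion_unique[where c = "\<lambda>k. theta_coeffs a x k - c k", OF a order_refl A_diff[OF y z(1)] _ that] by blast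
  then have "(of_int (theta_coeffs a x k) :: 'p mod_ring) = of_int (c k)" if "k < p - 1" for k
    using that by (simp add: of_int_mod_ring_eq_iff card)
  then show ?thesis unfolding jordan_coords_def by (intro eq_vecI) auto
qed

lemma jordan_coords_dim [simp]: "dim_vec (jordan_coords a x :: 'p mod_ring vec) = p - 1"
  by (simp add: jordan_coords_def)

lemma jordan_coordsE:
  assumes "x \<in> A"
  obtains c y where "y \<in> A" "x = (\<Sum>k<p - 1. of_int (c k) * \<theta> ^ k * a) + \<theta> ^ (p - 1) * y"
    "(jordan_coords a x :: 'p mod_ring vec) = vec (p - 1) (\<lambda>i. of_int (c (p - 2 - i)))"
  using theta_coeffs[OF a assms] unfolding jordan_coords_def by blast

lemma jordan_coords_add:
  assumes "x \<in> A" "y \<in> A"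
  shows "(jordan_coords a (x + y) :: 'p mod_ring vec) = jordan_coords a x + jordan_coords a y"
proof -
  obtain c x' where x': "x' \<in> A" "x = (\<Sum>k<p - 1. of_int (c k) * \<theta> ^ k * a) + \<theta> ^ (p - 1) * x'"
    "(jordan_coords a x :: 'p mod_ring vec) = vec (p - 1) (\<lambda>i. of_int (c (p - 2 - i)))"
    using jordan_coordsE[OF assms(1)] by blast
  obtain d y' where y': "y' \<in> A" "y = (\<Sum>k<p - 1. of_int (d k) * \<theta> ^ k * a) + \<theta> ^ (p - 1) * y'"
    "(jordan_coords a y :: 'p mod_ring vec) = vec (p - 1) (\<lambda>i. of_int (d (p - 2 - i)))"
    using jordan_coordsE[OF assms(2)] by blast
  have "x + y = (\<Sum>k<p - 1. of_int (c k + d k) * \<theta> ^ k * a) + \<theta> ^ (p - 1) * (x' + y')"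
    unfolding x'(2) y'(2) by (simp add: algebra_simps sum.distrib)
  from jordan_coords_eqI[OF A_add[OF x'(1) y'(1)] this] show ?thesis
    unfolding x'(3) y'(3) by (simp only:) (auto intro!: eq_vecI)
qed

lemma jordan_coords_surj:
  assumes "v \<in> carrier_vec (p - 1)"
  shows "\<exists>x\<in>A. (jordan_coords a x :: 'p mod_ring vec) = v"
proof -
  define c where "c k = to_int_mod_ring (v $ (p - 2 - k))" for k
  define x where "x = (\<Sum>k<p - 1. of_int (c k) * \<theta> ^ k * a)"
  have x: "x \<in> A" unfolding x_def
    by (intro A_sum A_mult O_mult O_of_int O_power O_theta a)
  have "(jordan_coords a x :: 'p mod_ring vec) = vec (p - 1) (\<lambda>i. of_int (c (p - 2 - i)))"
    by (rule jordan_coords_eqI[OF A_zero]) (simp add: x_def)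
  also have "\<dots> = v"
  proof (rule eq_vecI)
    fix i assume "i < dim_vec v"
    then have "i < p - 1" "p - 2 - (p - 2 - i) = i" using assms by auto
    then show "vec (p - 1) (\<lambda>i. of_int (c (p - 2 - i))) $ i = v $ i"
      by (simp only: index_vec c_def of_int_of_int_mod_ring of_int_mod_ring_to_int_mod_ring)
  qed (use assms in simp)
  finally show ?thesis using x by blast
qed

text \<open>Both parts of the expansion lie in p A: the sum because all its digits are divisible by
  p, the remainder because \<theta>^(p-1) A does.\<close>

lemma jordan_coords_kernel:
  assumes x: "x \<in> A" and "(jordan_coords a x :: 'p mod_ring vec) = 0\<^sub>v (p - 1)"
  shows "\<exists>y\<in>A. x = of_nat p * y"
proof -
  obtain c x' where x': "x' \<in> A" "x = (\<Sum>k<p - 1. of_int (c k) * \<theta> ^ k * a) + \<theta> ^ (p - 1) * x'"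
    and c: "(jordan_coords a x :: 'p mod_ring vec) = vec (p - 1) (\<lambda>i. of_int (c (p - 2 - i)))"
    using jordan_coordsE[OF x] by blast
  have "int p dvd c k" if k: "k < p - 1" for k
  proof -
    have k': "p - 2 - (p - 2 - k) = k" "p - 2 - k < p - 1" using k by linarith+
    have "(of_int (c k) :: 'p mod_ring) = jordan_coords a x $ (p - 2 - k)"
      unfolding c index_vec[OF k'(2)] k'(1) ..
    also have "\<dots> = 0" using k by (simp add: assms(2))
    finally show ?thesis using of_int_mod_ring_eq_iff[of _ 0, where 'p='p] by (simp add: card)
  qed
  then have "\<forall>k. \<exists>e. k < p - 1 \<longrightarrow> c k = int p * e" by (auto simp: dvd_def)
  then obtain e where e: "\<And>k. k < p - 1 \<Longrightarrow> c k = int p * e k" by metis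
  obtain z where z: "z \<in> A" "\<theta> ^ (p - 1) * x' = of_nat p * z"
    using theta_power_mult_eq[OF x'(1)] by blast
  have "(\<Sum>k<p - 1. of_int (c k) * \<theta> ^ k * a) = 
      of_nat p * (\<Sum>k<p - 1. of_int (e k) * \<theta> ^ k * a)"
    unfolding sum_distrib_left by (intro sum.cong) (auto simp: e)
  then have "x = of_nat p * ((\<Sum>k<p - 1. of_int (e k) * \<theta> ^ k * a) + z)"
    using x'(2) z(2) by (simp add: algebra_simps)
  moreover have "(\<Sum>k<p - 1. of_int (e k) * \<theta> ^ k * a) + z \<in> A"
    by (intro A_add A_sum A_mult O_mult O_of_int O_power O_theta a z)
  ultimately show ?thesis by blast
qed

text \<open>\<xi> x = x + \<theta> x, and multiplication by \<theta> moves every digit one place up.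
  In the reversed listing this is the superdiagonal.\<close>

lemma jordan_coords_act:
  assumes x: "x \<in> A"
  shows "(jordan_coords a (\<xi> * x) :: 'p mod_ring vec) = jordan_block (p - 1) 1 *\<^sub>v jordan_coords a x"
proof -
  define n where "n = p - 2"
  have n: "p - 1 = Suc n" "p - 2 = n" using p_gt_1 unfolding n_def by linarith+
  obtain c x' where x': "x' \<in> A" "x = (\<Sum>k<Suc n. of_int (c k) * \<theta> ^ k * a) + \<theta> ^ Suc n * x'"
    and c: "(jordan_coords a x :: 'p mod_ring vec) = vec (p - 1) (\<lambda>i. of_int (c (p - 2 - i)))"
    using jordan_coordsE[OF x] unfolding n(1)[symmetric] by blast
  define d where "d k = (if k = 0 then 0 else c (k - 1))" for k
  have "\<theta> * (\<Sum>k<Suc n. of_int (c k) * \<theta> ^ k * a) =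
    (\<Sum>k<Suc n. of_int (d k) * \<theta> ^ k * a) + of_int (c n) * \<theta> ^ Suc n * a"
    unfolding sum.lessThan_Suc_shift[of "\<lambda>k. of_int (d k) * \<theta> ^ k * a" n]
    by (simp add: d_def sum_distrib_left algebra_simps)
  \<comment> \<open>The top digit leaves the range: its term \<theta>^(p-1) a joins the remainder,
    which is invisible modulo p.\<close>
  then have "x + \<theta> * x = (\<Sum>k<Suc n. of_int (c k + d k) * \<theta> ^ k * a) + \<theta> ^ Suc n * (x' + of_int (c n) * a + \<theta> * x')"
    unfolding x'(2) distrib_left by (simp add: sum.distrib algebra_simps)
  also have "x + \<theta> * x = \<xi> * x" by (simp add: \<theta>_def algebra_simps)
  finally have "(jordan_coords a (\<xi> * x) :: 'p mod_ring vec) = vec (p - 1) (\<lambda>i. of_int (c (p - 2 - i) + d (p - 2 - i)))"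
    unfolding n(1)[symmetric]
    by (intro jordan_coords_eqI[of "x' + of_int (c n) * a + \<theta> * x'"] A_add A_mult O_of_int O_theta a x') auto
  also have "\<dots> = jordan_block (p - 1) 1 *\<^sub>v jordan_coords a x"
  proof (rule eq_vecI)
    fix i assume "i < dim_vec (jordan_block (p - 1) 1 *\<^sub>v jordan_coords a x :: 'p mod_ring vec)"
    then have i: "i < p - 1" by simp
    have "(jordan_block (p - 1) 1 *\<^sub>v jordan_coords a x :: 'p mod_ring vec) $ i =
      jordan_coords a x $ i + (if Suc i < p - 1 then jordan_coords a x $ Suc i else 0)"
      by (rule jordan_block_mult_vec[OF carrier_vecI i]) (simp)
    also have "\<dots> = of_int (c (p - 2 - i) + d (p - 2 - i))"
    proof (cases "Suc i < p - 1")
      case True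
      then have "p - 2 - Suc i = p - 2 - i - 1" "p - 2 - i \<noteq> 0" by linarith+
      with True i show ?thesis by (simp add: c d_def)
    next
      case False
      then have "p - 2 - i = 0" using i by linarith
      with False i show ?thesis by (simp add: c d_def)
    qed
    finally show "vec (p - 1) (\<lambda>i. of_int (c (p - 2 - i) + d (p - 2 - i))) $ i =
      (jordan_block (p - 1) 1 *\<^sub>v jordan_coords a x :: 'p mod_ring vec) $ i"
      using i by simp
  qed simp
  finally show ?thesis .
qed

lemma jordan_coords_int_mult:
  assumes x: "x \<in> A"
  shows "(jordan_coords a (of_int k * x) :: 'p mod_ring vec) = of_int k \<cdot>\<^sub>v jordan_coords a x"
proof -
  obtain c x' where x': "x' \<in> A" "x = (\<Sum>k<p - 1. of_int (c k) * \<theta> ^ k * a) + \<theta> ^ (p - 1) * x'"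
    and c: "(jordan_coords a x :: 'p mod_ring vec) = vec (p - 1) (\<lambda>i. of_int (c (p - 2 - i)))"
    using jordan_coordsE[OF x] by blast
  have "of_int k * x = (\<Sum>j<p - 1. of_int (k * c j) * \<theta> ^ j * a) + \<theta> ^ (p - 1) * (of_int k * x')"
    unfolding x'(2) by (simp add: distrib_left sum_distrib_left mult_ac)
  from jordan_coords_eqI[OF A_mult[OF O_of_int x'(1)] this] show ?thesis
    unfolding c by (simp only:) (auto intro!: eq_vecI)
qed

lemma jordan_coords_self: "(jordan_coords a a :: 'p mod_ring vec) = unit_vec (p - 1) (p - 2)"
proof -
  define c where "c k = (if k = 0 then 1 else 0 :: int)" for k :: nat
  have "(\<Sum>k<p - 1. of_int (c k) * \<theta> ^ k * a) = (\<Sum>k<p - 1. if k = 0 then a else 0)"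
    by (intro sum.cong) (auto simp: c_def)
  then have "a = (\<Sum>k<p - 1. of_int (c k) * \<theta> ^ k * a) + \<theta> ^ (p - 1) * 0"
    using p_gt_1 by simp
  from jordan_coords_eqI[OF A_zero this] show ?thesis
    using p_gt_1 by (simp only:) (auto simp: c_def unit_vec_def intro!: eq_vecI)
qed

text \<open>In \<open>(A, a)\<close> the chain of \<open>a\<close> is prolonged by \<open>(0, 1)\<close>, which \<open>\<phi> - 1\<close> maps to \<open>(a, 0)\<close>.\<close>

definition ext_coords :: "complex \<times> int \<Rightarrow> 'p mod_ring vec" where
  "ext_coords = (\<lambda>(x, k). vec p (\<lambda>i. if i < p - 1 then jordan_coords a x $ i else of_int k))"

lemma ext_coords_add:
  "x \<in> A \<Longrightarrow> y \<in> A \<Longrightarrow> ext_coords (x + y, k + l) = ext_coords (x, k) + ext_coords (y, l)"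
  by (intro eq_vecI) (auto simp: ext_coords_def jordan_coords_add)

lemma ext_coords_surj:
  assumes "v \<in> carrier_vec p"
  shows "\<exists>x\<in>A. \<exists>k. ext_coords (x, k) = v"
proof -
  obtain x where x: "x \<in> A" "(jordan_coords a x :: 'p mod_ring vec) = vec (p - 1) (\<lambda>i. v $ i)"
    using jordan_coords_surj[of "vec (p - 1) (\<lambda>i. v $ i)"] by auto
  have "ext_coords (x, to_int_mod_ring (v $ (p - 1))) = v"
  proof (rule eq_vecI)
    fix i assume "i < dim_vec v"
    then have "i < p" "\<not> i < p - 1 \<Longrightarrow> i = p - 1" using assms by auto
    then show "ext_coords (x, to_int_mod_ring (v $ (p - 1))) $ i = v $ i"
      by (auto simp: ext_coords_def x(2) of_int_of_int_mod_ring)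
  qed (use assms in \<open>simp add: ext_coords_def\<close>)
  with x(1) show ?thesis by blast
qed

lemma ext_coords_kernel:
  assumes x: "x \<in> A" and 0: "ext_coords (x, k) = 0\<^sub>v p"
  shows "\<exists>y\<in>A. \<exists>l. x = of_nat p * y \<and> k = int p * l"
proof -
  have "(jordan_coords a x :: 'p mod_ring vec) = 0\<^sub>v (p - 1)"
  proof (rule eq_vecI)
    fix i assume "i < dim_vec (0\<^sub>v (p - 1) :: 'p mod_ring vec)"
    then have i: "i < p - 1" by simp
    then have "ext_coords (x, k) $ i = 0" unfolding 0 by simp
    with i show "(jordan_coords a x :: 'p mod_ring vec) $ i = 0\<^sub>v (p - 1) $ i" by (simp add: ext_coords_def)
  qed simp
  then obtain y where "y \<in> A" "x = of_nat p * y" using jordan_coords_kernel[OF x] by blast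
  moreover have "ext_coords (x, k) $ (p - 1) = 0" unfolding 0 using p_gt_1 by simp
  then have "(of_int k :: 'p mod_ring) = 0" using p_gt_1 by (simp add: ext_coords_def)
  then have "int p dvd k" using of_int_mod_ring_eq_iff[of k 0, where 'p='p] by (simp add: card)
  ultimately show ?thesis by (auto simp: dvd_def)
qed

lemma ext_coords_act:
  assumes x: "x \<in> A"
  shows "ext_coords (ext_act \<xi> a (x, k)) = jordan_block p 1 *\<^sub>v ext_coords (x, k)"
proof (rule eq_vecI)
  fix i assume "i < dim_vec (jordan_block p 1 *\<^sub>v ext_coords (x, k))"
  then have i: "i < p" by simp
  have rhs: "(jordan_block p 1 *\<^sub>v ext_coords (x, k)) $ i =
      ext_coords (x, k) $ i + (if Suc i < p then ext_coords (x, k) $ Suc i else 0)"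
    by (rule jordan_block_mult_vec[OF carrier_vecI i]) (simp add: ext_coords_def)
  show "ext_coords (ext_act \<xi> a (x, k)) $ i = (jordan_block p 1 *\<^sub>v ext_coords (x, k)) $ i"
  proof (cases "i < p - 1")
    case True
    have "ext_coords (ext_act \<xi> a (x, k)) $ i = (jordan_coords a (\<xi> * x + of_int k * a) :: 'p mod_ring vec) $ i"
      using True by (simp add: ext_coords_def ext_act_def)
    also have "\<dots> = (jordan_block (p - 1) 1 *\<^sub>v jordan_coords a x :: 'p mod_ring vec) $ i 
        + of_int k * (unit_vec (p - 1) (p - 2) $ i)"
      using True by (simp add: jordan_coords_add jordan_coords_act jordan_coords_int_mult
          jordan_coords_self A_mult O_xi O_of_int x a del: index_mult_mat_vec)
    also have "(jordan_block (p - 1) 1 *\<^sub>v jordan_coords a x :: 'p mod_ring vec) $ i =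
      jordan_coords a x $ i + (if Suc i < p - 1 then jordan_coords a x $ Suc i else 0)"
      by (rule jordan_block_mult_vec[OF carrier_vecI True]) (simp)
    \<comment> \<open>At i = p - 2 the block of size p - 1 has no further superdiagonal entry; there
      the unit vector of a contributes k, which is the entry p - 1 of the longer vector.\<close>
    finally show ?thesis
      unfolding rhs using True by (cases "Suc i < p - 1") (auto simp: ext_coords_def)
  next
    case False
    then show ?thesis unfolding rhs using i by (auto simp: ext_coords_def ext_act_def)
  qed
qed (simp add: ext_coords_def ext_act_def)

end

text \<open>A fixed vector solves \<theta> x = -k a, so k a must lie in \<theta> A; as a does not,
  this means that p divides k.\<close>

lemma ext_act_fixed_iff:
  assumes a: "a \<in> A" "a \<notin> \<theta>A"
  shows "(\<exists>x\<in>A. ext_act \<xi> a (x, k) = (x, k)) \<longleftrightarrow> int p dvd k"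
proof
  assume "\<exists>x\<in>A. ext_act \<xi> a (x, k) = (x, k)"
  then obtain x where x: "x \<in> A" "\<xi> * x + of_int k * a = x" by (auto simp: ext_act_def)
  then have "of_int k * a = \<theta> * (- x)" by (simp add: \<theta>_def algebra_simps)
  then have "of_int k * a \<in> \<theta>A" using A_uminus[OF x(1)] by blast
  then show "int p dvd k" using thetaA_coprime[OF a(1)] a(2) by blast
next
  assume "int p dvd k"
  then obtain e where e: "k = int p * e" by (elim dvdE)
  obtain z where z: "z \<in> A" "of_nat p * (of_int e * a) = \<theta> * z"
    using p_mult_thetaA[OF A_mult[OF O_of_int a(1)]] by blast
  then have "ext_act \<xi> a (- z, k) = (- z, k)"
    by (simp add: ext_act_def e \<theta>_def algebra_simps)
  then show "\<exists>x\<in>A. ext_act \<xi> a (x, k) = (x, k)" using A_uminus[OF z(1)] by blast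
qed

end


section \<open>The decomposition modulo \<open>p\<close>\<close>

lemma hom_nat_pow:
  assumes "f \<in> hom G H" "group G" "group H" "x \<in> carrier G"
  shows "f (x [^]\<^bsub>G\<^esub> (n :: nat)) = f x [^]\<^bsub>H\<^esub> n"
proof (induction n)
  case 0
  show ?case using hom_one[OF assms(1-3)] by simp
next
  case (Suc n)
  have "x [^]\<^bsub>G\<^esub> n \<in> carrier G"
    by (rule monoid.nat_pow_closed[OF group.is_monoid[OF assms(2)] assms(4)])
  then show ?case using Suc hom_mult[OF assms(1) _ assms(4)] by simp
qed

lemma group_ideal_group:
  assumes "ideal A (Z_adjoin \<xi>)"
  shows "group (ideal_group A)"
proof -
  interpret ideal A "Z_adjoin \<xi>" by (rule assms)
  have "group (add_monoid (Z_adjoin \<xi>)\<lparr>carrier := A\<rparr>)"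
    by (rule subgroup.subgroup_is_group[OF a_subgroup a_group])
  also have "add_monoid (Z_adjoin \<xi>)\<lparr>carrier := A\<rparr> = ideal_group A"
    by (simp add: Z_adjoin_def ideal_group_def)
  finally show ?thesis .
qed

lemma ideal_group_simps [simp]:
  "carrier (ideal_group A) = A" "x \<otimes>\<^bsub>ideal_group A\<^esub> y = x + y" "\<one>\<^bsub>ideal_group A\<^esub> = 0"
  by (simp_all add: ideal_group_def)

lemma nat_pow_ideal_group [simp]: "x [^]\<^bsub>ideal_group A\<^esub> (n :: nat) = of_nat n * x"
  by (induction n) (simp_all add: algebra_simps)

lemma group_decomp_group:
  assumes "\<And>i. i \<in> {1..r+s} \<Longrightarrow> ideal (A i) (Z_adjoin \<xi>)"
  shows "group (decomp_group r s t A)"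
  unfolding decomp_group_def
  by (intro DirProd_group product_group group_ideal_group[of _ \<xi>] group_integer_group assms) auto

lemma carrier_decomp_group: "carrier (decomp_group r s t A) =
   (\<Pi>\<^sub>E i\<in>{1..r}. A i \<times> UNIV) \<times> (\<Pi>\<^sub>E i\<in>{r+1..r+s}. A i) \<times> (\<Pi>\<^sub>E i\<in>{1..t}. UNIV)"
  by (simp add: decomp_group_def)

lemma mult_decomp_group: "(u, v, w) \<otimes>\<^bsub>decomp_group r s t A\<^esub> (u', v', w') =
   (\<lambda>i\<in>{1..r}. (fst (u i) + fst (u' i), snd (u i) + snd (u' i)), \<lambda>i\<in>{r+1..r+s}. v i + v' i, \<lambda>i\<in>{1..t}. w i + w' i)"
  by (auto simp: decomp_group_def DirProd_def split: prod.splits intro!: restrict_ext)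

lemma one_decomp_group: "\<one>\<^bsub>decomp_group r s t A\<^esub> = 
   (\<lambda>i\<in>{1..r}. (0, 0), \<lambda>i\<in>{r+1..r+s}. 0, \<lambda>i\<in>{1..t}. 0)"
  by (simp add: decomp_group_def)

lemma nat_pow_decomp_group: "(u, v, w) [^]\<^bsub>decomp_group r s t A\<^esub> (n :: nat) =
   (\<lambda>i\<in>{1..r}. (of_nat n * fst (u i), int n * snd (u i)), \<lambda>i\<in>{r+1..r+s}. of_nat n * v i, \<lambda>i\<in>{1..t}. int n * w i)"
proof (induction n)
  case 0
  show ?case by (simp add: one_decomp_group restrict_def)
next
  case (Suc n)
  show ?case
    by (simp add: Suc mult_decomp_group algebra_simps restrict_def cong: if_cong)
qed

text \<open>Infinite p-divisibility is preserved by the embedding into the free group, where every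
  integer coordinate is then divisible by all powers of p and so vanishes.\<close>

lemma iso_free_Abelian_group_divisible:
  assumes T: "free_of_rank T n" and h: "h \<in> hom M T" "inj_on h (carrier M)" and M: "group M"
    and x: "x \<in> carrier M" and div: "\<And>k. \<exists>y\<in>carrier M. x = y [^]\<^bsub>M\<^esub> (p ^ k)" and p: "p > (1 :: nat)"
  shows "x = \<one>\<^bsub>M\<^esub>"
proof -
  interpret T: comm_group T using T by (simp add: free_of_rank_def)
  obtain g where g: "g \<in> iso T (free_Abelian_group {..<n})"
    using T by (auto simp: free_of_rank_def is_iso_def)
  then have g_hom: "g \<in> hom T (free_Abelian_group {..<n})" and g_inj: "inj_on g (carrier T)"
    by (auto simp: iso_def bij_betw_def)
  have hT: "h y \<in> carrier T" if "y \<in> carrier M" for y using h(1) that by (auto simp: hom_def)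
  have "Poly_Mapping.lookup (g (h x)) i = 0" for i
  proof -
    have dvd: "int p ^ k dvd Poly_Mapping.lookup (g (h x)) i" for k
    proof -
      obtain y where y: "y \<in> carrier M" "x = y [^]\<^bsub>M\<^esub> (p ^ k)" using div by blast
      have "g (h x) = frag_cmul (int (p ^ k)) (g (h y))"
        unfolding y(2) hom_nat_pow[OF h(1) M T.group_axioms y(1)]
          hom_nat_pow[OF g_hom T.group_axioms group_free_Abelian_group hT[OF y(1)]] by simp
      then show ?thesis by simp
    qed
    define m where "m = Poly_Mapping.lookup (g (h x)) i"
    \<comment> \<open>The exponent is chosen as the absolute value of m itself, which p^|m| exceeds;
      a nonzero m cannot have such a divisor.\<close>
    have "nat \<bar>m\<bar> < p ^ nat \<bar>m\<bar>" using p by (simp add: power_gt_expt)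
    then have "int (nat \<bar>m\<bar>) < int (p ^ nat \<bar>m\<bar>)" by linarith
    then have "\<bar>m\<bar> < int p ^ nat \<bar>m\<bar>" by simp
    then show ?thesis using dvd[of "nat \<bar>m\<bar>"] dvd_imp_le_int[of m "int p ^ nat \<bar>m\<bar>"]
      unfolding m_def[symmetric] by (cases "m = 0") auto
  qed
  then have "g (h x) = 0" by (intro poly_mapping_eqI) simp
  also have "\<dots> = g (h \<one>\<^bsub>M\<^esub>)"
    using hom_one[OF h(1) M T.group_axioms] hom_one[OF g_hom T.group_axioms] by simp
  finally have "h x = h \<one>\<^bsub>M\<^esub>"
    using g_inj hT x group.is_monoid[OF M] monoid.one_closed by (metis inj_onD)
  then show ?thesis using h(2) x group.is_monoid[OF M] monoid.one_closed by (metis inj_onD)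
qed

text \<open>The ideal embeds into the decomposition as its i-th summand, and from there into T
  through the inverse isomorphism.\<close>

lemma ideal_separated_of_free:
  assumes T: "free_of_rank T n" and f: "f \<in> iso T (decomp_group r s t A)"
    and ideal: "\<And>i. i \<in> {1..r+s} \<Longrightarrow> ideal (A i) (Z_adjoin \<xi>)" and i: "i \<in> {1..r+s}"
    and p: "p > 1" and x: "x \<in> A i" and div: "\<And>k. \<exists>y\<in>A i. x = of_nat p ^ k * y"
  shows "x = 0"
proof -
  interpret T: comm_group T using T by (simp add: free_of_rank_def)
  let ?D = "decomp_group r s t A"
  have zero: "0 \<in> A j" if "j \<in> {1..r+s}" for j
    using group.is_monoid[OF group_ideal_group[OF ideal[OF that]], THEN monoid.one_closed] by simp
  \<comment> \<open>Written for both kinds of summands at once: i lies in exactly one of the two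
    index ranges, and the other component is zero.\<close>
  define e where "e x = (\<lambda>j\<in>{1..r}. (if j = i then x else 0 :: complex, 0 :: int),
      \<lambda>j\<in>{r+1..r+s}. if j = i then x else 0 :: complex, \<lambda>j\<in>{1..t}. 0 :: int)" for x
  have e: "e \<in> hom (ideal_group (A i)) ?D"
  proof (rule homI)
    fix x assume "x \<in> carrier (ideal_group (A i))"
    then show "e x \<in> carrier ?D" using zero by (auto simp: e_def carrier_decomp_group)
  qed (auto simp: e_def mult_decomp_group intro!: restrict_ext)
  have e_inj: "inj_on e (carrier (ideal_group (A i)))"
  proof (rule inj_onI)
    fix x y assume "e x = e y"
    then have 1: "(\<lambda>j\<in>{1..r}. (if j = i then x else 0, 0 :: int)) i = (\<lambda>j\<in>{1..r}. (if j = i then y else 0, 0)) i"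
      and 2: "(\<lambda>j\<in>{r+1..r+s}. if j = i then x else 0) i = (\<lambda>j\<in>{r+1..r+s}. if j = i then y else 0) i"
      unfolding e_def by (metis prod.inject)+
    show "x = y"
    proof (cases "i \<le> r")
      case True
      with 1 i show ?thesis by simp
    next
      case False
      with 2 i show ?thesis by simp
    qed
  qed
  have g: "inv_into (carrier T) f \<in> iso ?D T" by (rule T.iso_set_sym[OF f])
  have "x = \<one>\<^bsub>ideal_group (A i)\<^esub>"
  proof (rule iso_free_Abelian_group_divisible[OF T])
    show "inv_into (carrier T) f \<circ> e \<in> hom (ideal_group (A i)) T"
      using g by (intro hom_compose[OF e]) (simp add: iso_def)
    show "inj_on (inv_into (carrier T) f \<circ> e) (carrier (ideal_group (A i)))"
    proof (rule comp_inj_on[OF e_inj])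
      have "e ` carrier (ideal_group (A i)) \<subseteq> carrier ?D" using e by (auto simp: hom_def)
      then show "inj_on (inv_into (carrier T) f) (e ` carrier (ideal_group (A i)))"
        using g by (auto simp: iso_def bij_betw_def intro: inj_on_subset)
    qed
  qed (use x div p group_ideal_group[OF ideal[OF i]] in auto)
  then show ?thesis by simp
qed

text \<open>A sum of three terms instead of a case distinction, so that for p = 2 the contributions
  s and t to size 1 add up.\<close>

definition decomp_mult :: "nat \<Rightarrow> nat \<Rightarrow> nat \<Rightarrow> nat \<Rightarrow> nat \<Rightarrow> nat" where
  "decomp_mult p r s t q = (if q = p then r else 0) + (if q = p - 1 then s else 0) + (if q = 1 then t else 0)"

text \<open>\<open>generators\<close> covers all i up to r + s. For i <= r the element
  \<open>a i\<close> occurs in the action; beyond r it only serves as the start of a Jordan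
  chain.\<close>

locale decomposition =
  fixes \<xi> :: complex and p r s t :: nat and A :: "nat \<Rightarrow> complex set" and a :: "nat \<Rightarrow> complex"
    and ty :: "'p::prime_card itself"
  assumes prime: "prime p" and root: "primitive_root_of_unity p \<xi>" and card: "CARD('p) = p"
    and ideals: "\<And>i. i \<in> {1..r+s} \<Longrightarrow> cyclotomic_ideal \<xi> p (A i)"
    and generators: "\<And>i. i \<in> {1..r+s} \<Longrightarrow> a i \<in> A i \<and> a i \<notin> (\<lambda>x. (\<xi> - 1) * x) ` A i"
begin

abbreviation D where "D \<equiv> decomp_group r s t A"
abbreviation l where "l \<equiv> decomp_mult p r s t"
abbreviation W :: "('p mod_ring, nat \<times> nat \<Rightarrow> 'p mod_ring vec) module" where "W \<equiv> jordan_sum l"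
abbreviation jcoords :: "nat \<Rightarrow> complex \<Rightarrow> 'p mod_ring vec" where
  "jcoords i \<equiv> cyclotomic_ideal.jordan_coords \<xi> p (A i) (a i)"
abbreviation ecoords :: "nat \<Rightarrow> complex \<times> int \<Rightarrow> 'p mod_ring vec" where
  "ecoords i \<equiv> cyclotomic_ideal.ext_coords \<xi> p (A i) (a i)"

lemma p_gt_1: "p > 1" using prime by (rule prime_gt_1_nat)

lemma prime_cyclotomic: "prime_cyclotomic \<xi> p"
  using prime root by unfold_locales

lemma generator: "i \<in> {1..r+s} \<Longrightarrow> a i \<in> A i"
  and generator_not_in: "i \<in> {1..r+s} \<Longrightarrow> a i \<notin> (\<lambda>x. prime_cyclotomic.\<theta> \<xi> * x) ` A i"
  using generators prime_cyclotomic.\<theta>_def[OF prime_cyclotomic] by auto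

lemma jcoords:
  assumes i: "i \<in> {1..r+s}"
  shows jcoords_dim: "dim_vec (jcoords i x) = p - 1"
    and jcoords_add: "x \<in> A i \<Longrightarrow> y \<in> A i \<Longrightarrow> jcoords i (x + y) = jcoords i x + jcoords i y"
    and jcoords_surj: "v \<in> carrier_vec (p - 1) \<Longrightarrow> \<exists>x\<in>A i. jcoords i x = v"
    and jcoords_kernel: "x \<in> A i \<Longrightarrow> jcoords i x = 0\<^sub>v (p - 1) \<Longrightarrow> \<exists>y\<in>A i. x = of_nat p * y"
    and jcoords_act: "x \<in> A i \<Longrightarrow> jcoords i (\<xi> * x) = jordan_block (p - 1) 1 *\<^sub>v jcoords i x"
    and ecoords_dim: "dim_vec (ecoords i z) = p"
    and ecoords_add: "x \<in> A i \<Longrightarrow> y \<in> A i \<Longrightarrow> ecoords i (x + y, k + m) = ecoords i (x, k) + ecoords i (y, m)"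
    and ecoords_surj: "v \<in> carrier_vec p \<Longrightarrow> \<exists>x\<in>A i. \<exists>k. ecoords i (x, k) = v"
    and ecoords_kernel: "x \<in> A i \<Longrightarrow> ecoords i (x, k) = 0\<^sub>v p \<Longrightarrow> \<exists>y\<in>A i. \<exists>m. x = of_nat p * y \<and> k = int p * m"
    and ecoords_act: "x \<in> A i \<Longrightarrow> ecoords i (ext_act \<xi> (a i) (x, k)) = jordan_block p 1 *\<^sub>v ecoords i (x, k)"
proof -
  interpret cyclotomic_ideal \<xi> p "A i" by (rule ideals[OF i])
  note c = card generator[OF i] generator_not_in[OF i]
  show "dim_vec (jcoords i x) = p - 1" by (rule jordan_coords_dim[OF c])
  show "x \<in> A i \<Longrightarrow> y \<in> A i \<Longrightarrow> jcoords i (x + y) = jcoords i x + jcoords i y" by (rule jordan_coords_add[OF c])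
  show "v \<in> carrier_vec (p - 1) \<Longrightarrow> \<exists>x\<in>A i. jcoords i x = v" by (rule jordan_coords_surj[OF c])
  show "x \<in> A i \<Longrightarrow> jcoords i x = 0\<^sub>v (p - 1) \<Longrightarrow> \<exists>y\<in>A i. x = of_nat p * y" by (rule jordan_coords_kernel[OF c])
  show "x \<in> A i \<Longrightarrow> jcoords i (\<xi> * x) = jordan_block (p - 1) 1 *\<^sub>v jcoords i x" by (rule jordan_coords_act[OF c])
  show "dim_vec (ecoords i z) = p" by (simp add: ext_coords_def[OF c] split_beta)
  show "x \<in> A i \<Longrightarrow> y \<in> A i \<Longrightarrow> ecoords i (x + y, k + m) = ecoords i (x, k) + ecoords i (y, m)" by (rule ext_coords_add[OF c])
  show "v \<in> carrier_vec p \<Longrightarrow> \<exists>x\<in>A i. \<exists>k. ecoords i (x, k) = v" by (rule ext_coords_surj[OF c])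
  show "x \<in> A i \<Longrightarrow> ecoords i (x, k) = 0\<^sub>v p \<Longrightarrow> \<exists>y\<in>A i. \<exists>m. x = of_nat p * y \<and> k = int p * m" by (rule ext_coords_kernel[OF c])
  show "x \<in> A i \<Longrightarrow> ecoords i (ext_act \<xi> (a i) (x, k)) = jordan_block p 1 *\<^sub>v ecoords i (x, k)" by (rule ext_coords_act[OF c])
qed

text \<open>For \<open>p = 2\<close> the ideals and the trivial summands both contribute blocks of size 1.\<close>

definition offset :: nat where "offset = (if p = 2 then s else 0)"

definition idx_u :: "nat \<Rightarrow> nat \<times> nat" where "idx_u k = (p, k - 1)"
definition idx_v :: "nat \<Rightarrow> nat \<times> nat" where "idx_v k = (p - 1, k - r - 1)"
definition idx_w :: "nat \<Rightarrow> nat \<times> nat" where "idx_w k = (1, k - 1 + offset)"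

lemma fst_idx [simp]: "fst (idx_u k) = p" "fst (idx_v k) = p - 1" "fst (idx_w k) = 1"
  by (simp_all add: idx_u_def idx_v_def idx_w_def)

lemma jordan_idx_eq: "jordan_idx p l = idx_u ` {1..r} \<union> idx_v ` {r+1..r+s} \<union> idx_w ` {1..t}"
proof -
  have "(q, j) \<in> idx_u ` {1..r} \<longleftrightarrow> q = p \<and> j < r" for q j
    by (auto simp: idx_u_def intro!: image_eqI[of _ _ "Suc j"])
  moreover have "(q, j) \<in> idx_v ` {r+1..r+s} \<longleftrightarrow> q = p - 1 \<and> j < s" for q j
    by (auto simp: idx_v_def intro!: image_eqI[of _ _ "r + Suc j"])
  moreover have "(q, j) \<in> idx_w ` {1..t} \<longleftrightarrow> q = 1 \<and> offset \<le> j \<and> j < t + offset" for q j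
    by (auto simp: idx_w_def intro!: image_eqI[of _ _ "Suc (j - offset)"])
  moreover have "(q, j) \<in> jordan_idx p l \<longleftrightarrow>
    q = p \<and> j < r \<or> q = p - 1 \<and> j < s \<or> q = 1 \<and> offset \<le> j \<and> j < t + offset" for q j
    unfolding jordan_idx_def decomp_mult_def offset_def using p_gt_1 by auto
  ultimately have "\<forall>q j. (q, j) \<in> jordan_idx p l \<longleftrightarrow> (q, j) \<in> idx_u ` {1..r} \<union> idx_v ` {r+1..r+s} \<union> idx_w ` {1..t}"
    by (simp only: Un_iff) blast
  then show ?thesis unfolding set_eq_iff split_paired_All .
qed

lemma jordan_idx_cases:
  assumes "i \<in> jordan_idx p l"
  obtains (u) k where "k \<in> {1..r}" "i = idx_u k"
    | (v) k where "k \<in> {r+1..r+s}" "i = idx_v k"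
    | (w) k where "k \<in> {1..t}" "i = idx_w k"
  using assms unfolding jordan_idx_eq by blast

lemma idx_in: 
  "k \<in> {1..r} \<Longrightarrow> idx_u k \<in> jordan_idx p l"
  "k \<in> {r+1..r+s} \<Longrightarrow> idx_v k \<in> jordan_idx p l"
  "k \<in> {1..t} \<Longrightarrow> idx_w k \<in> jordan_idx p l"
  unfolding jordan_idx_eq by blast+

text \<open>Inverse to the placement by \<open>idx_u\<close>, \<open>idx_v\<close> and
  \<open>idx_w\<close>. The test \<open>snd i < s\<close> separates ideals from trivial summands
  when p = 2, where both sit at size 1.\<close>

definition coords ::
  "(nat \<Rightarrow> complex \<times> int) \<times> (nat \<Rightarrow> complex) \<times> (nat \<Rightarrow> int) \<Rightarrow> nat \<times> nat \<Rightarrow> 'p mod_ring vec" where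
  "coords = (\<lambda>(u, v, w). \<lambda>i\<in>jordan_idx p l.
    if fst i = p then ecoords (snd i + 1) (u (snd i + 1))
    else if fst i = p - 1 \<and> snd i < s then jcoords (r + snd i + 1) (v (r + snd i + 1))
    else vec 1 (\<lambda>_. of_int (w (snd i + 1 - offset))))"

lemma coords_u: "k \<in> {1..r} \<Longrightarrow> coords (u, v, w) (idx_u k) = ecoords k (u k)"
  using idx_in(1)[of k] by (simp add: coords_def) (simp add: idx_u_def)

lemma coords_v: "k \<in> {r+1..r+s} \<Longrightarrow> coords (u, v, w) (idx_v k) = jcoords k (v k)"
  using idx_in(2)[of k] p_gt_1 by (simp add: coords_def) (auto simp: idx_v_def)

lemma coords_w: "k \<in> {1..t} \<Longrightarrow> coords (u, v, w) (idx_w k) = vec 1 (\<lambda>_. of_int (w k))"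
  using idx_in(3)[of k] p_gt_1 by (simp add: coords_def) (auto simp: idx_w_def offset_def)

lemmas coords_simps = coords_u coords_v coords_w

lemma coords_outside: "i \<notin> jordan_idx p l \<Longrightarrow> coords z i = undefined"
  by (simp add: coords_def split_beta)

lemma carrier_W: "carrier W = (\<Pi>\<^sub>E i\<in>jordan_idx p l. carrier_vec (fst i))"
  by (simp add: jordan_sum_simps card)

lemma coords_closed: "coords z \<in> carrier W"
proof -
  obtain u v w where z: "z = (u, v, w)" by (cases z)
  have "coords z i \<in> carrier_vec (fst i)" if "i \<in> jordan_idx p l" for i
  proof (rule carrier_vecI)
    show "dim_vec (coords z i) = fst i"
      using that by (cases i rule: jordan_idx_cases) (simp_all add: z coords_simps jcoords_dim ecoords_dim)
  qed
  then show ?thesis unfolding carrier_W by (intro PiE_I coords_outside)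
qed

lemma W_eqI:
  assumes "x \<in> carrier W" "y \<in> carrier W"
    and "\<And>k. k \<in> {1..r} \<Longrightarrow> x (idx_u k) = y (idx_u k)"
    and "\<And>k. k \<in> {r+1..r+s} \<Longrightarrow> x (idx_v k) = y (idx_v k)"
    and "\<And>k. k \<in> {1..t} \<Longrightarrow> x (idx_w k) = y (idx_w k)"
  shows "x = y"
proof (rule PiE_ext)
  fix i assume "i \<in> jordan_idx p l"
  then show "x i = y i" using assms(3-5) by (cases i rule: jordan_idx_cases) simp_all
qed (use assms(1,2) carrier_W in simp_all)

lemma D_E:
  assumes "z \<in> carrier D"
  obtains u v w where "z = (u, v, w)" "\<And>k. k \<in> {1..r} \<Longrightarrow> fst (u k) \<in> A k"
    "\<And>k. k \<in> {r+1..r+s} \<Longrightarrow> v k \<in> A k"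
    "u \<in> extensional {1..r}" "v \<in> extensional {r+1..r+s}" "w \<in> extensional {1..t}"
proof -
  obtain u v w where z: "z = (u, v, w)" by (cases z)
  then have "u \<in> (\<Pi>\<^sub>E i\<in>{1..r}. A i \<times> UNIV)" "v \<in> (\<Pi>\<^sub>E i\<in>{r+1..r+s}. A i)" "w \<in> (\<Pi>\<^sub>E i\<in>{1..t}. UNIV)"
    using assms by (simp_all only: carrier_decomp_group mem_Sigma_iff)
  then show ?thesis
    by (intro that[OF z]) (simp_all only: PiE_iff mem_Times_iff)
qed

lemma coords_mult:
  assumes "z \<in> carrier D" "z' \<in> carrier D"
  shows "coords (z \<otimes>\<^bsub>D\<^esub> z') = coords z \<oplus>\<^bsub>W\<^esub> coords z'"
proof -
  interpret W: module "class_ring :: 'p mod_ring ring" W by (rule module_jordan_sum)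
  obtain u v w where z: "z = (u, v, w)" "\<And>k. k \<in> {1..r} \<Longrightarrow> fst (u k) \<in> A k" "\<And>k. k \<in> {r+1..r+s} \<Longrightarrow> v k \<in> A k"
    using assms(1) by (rule D_E) blast
  obtain u' v' w' where z': "z' = (u', v', w')" "\<And>k. k \<in> {1..r} \<Longrightarrow> fst (u' k) \<in> A k" "\<And>k. k \<in> {r+1..r+s} \<Longrightarrow> v' k \<in> A k"
    using assms(2) by (rule D_E) blast
  show ?thesis
  proof (rule W_eqI[OF coords_closed W.a_closed[OF coords_closed coords_closed]])
    fix k assume k: "k \<in> {1..r}"
    show "coords (z \<otimes>\<^bsub>D\<^esub> z') (idx_u k) = (coords z \<oplus>\<^bsub>W\<^esub> coords z') (idx_u k)"
      using k z(2)[OF k] z'(2)[OF k] idx_in(1)[OF k] ecoords_add[of k "fst (u k)" "fst (u' k)" "snd (u k)" "snd (u' k)"]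
      by (simp add: z(1) z'(1) mult_decomp_group coords_u jordan_sum_simps card)
  next
    fix k assume k: "k \<in> {r+1..r+s}"
    show "coords (z \<otimes>\<^bsub>D\<^esub> z') (idx_v k) = (coords z \<oplus>\<^bsub>W\<^esub> coords z') (idx_v k)"
      using k z(3)[OF k] z'(3)[OF k] idx_in(2)[OF k] jcoords_add[of k "v k" "v' k"]
      by (simp add: z(1) z'(1) mult_decomp_group coords_v jordan_sum_simps card)
  next
    fix k assume k: "k \<in> {1..t}"
    show "coords (z \<otimes>\<^bsub>D\<^esub> z') (idx_w k) = (coords z \<oplus>\<^bsub>W\<^esub> coords z') (idx_w k)"
      using k idx_in(3)[OF k]
      by (simp add: z(1) z'(1) mult_decomp_group coords_w jordan_sum_simps card) (auto intro!: eq_vecI)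
  qed
qed

lemma coords_surj: "coords ` carrier D = carrier W"
proof
  show "coords ` carrier D \<subseteq> carrier W" using coords_closed by blast
  show "carrier W \<subseteq> coords ` carrier D"
  proof
    fix y assume y: "y \<in> carrier W"
    then have y_closed: "y i \<in> carrier_vec (fst i)" if "i \<in> jordan_idx p l" for i
      using that unfolding carrier_W by blast
    have "\<exists>z\<in>A k \<times> UNIV. ecoords k z = y (idx_u k)" if "k \<in> {1..r}" for k
      using ecoords_surj[of k "y (idx_u k)"] y_closed[OF idx_in(1)[OF that]] that by auto
    then obtain u where u: "\<And>k. k \<in> {1..r} \<Longrightarrow> u k \<in> A k \<times> UNIV \<and> ecoords k (u k) = y (idx_u k)" by metis
    have "\<exists>z\<in>A k. jcoords k z = y (idx_v k)" if "k \<in> {r+1..r+s}" for k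
      using jcoords_surj[of k "y (idx_v k)"] y_closed[OF idx_in(2)[OF that]] that by auto
    then obtain v where v: "\<And>k. k \<in> {r+1..r+s} \<Longrightarrow> v k \<in> A k \<and> jcoords k (v k) = y (idx_v k)" by metis
    define w where "w k = to_int_mod_ring (y (idx_w k) $ 0)" for k
    define z where "z = (\<lambda>k\<in>{1..r}. u k, \<lambda>k\<in>{r+1..r+s}. v k, \<lambda>k\<in>{1..t}. w k)"
    have "z \<in> carrier D" using u v by (auto simp: z_def carrier_decomp_group)
    moreover have "coords z = y"
    proof (rule W_eqI[OF coords_closed y])
      fix k assume k: "k \<in> {1..t}"
      have "vec 1 (\<lambda>_. of_int (w k)) = y (idx_w k)"
        using y_closed[OF idx_in(3)[OF k]] by (intro eq_vecI) (auto simp: w_def of_int_of_int_mod_ring)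
      then show "coords z (idx_w k) = y (idx_w k)" using k by (simp add: z_def coords_w)
    qed (use u v in \<open>simp_all add: z_def coords_u coords_v\<close>)
    ultimately show "y \<in> coords ` carrier D" by blast
  qed
qed

text \<open>The p-th root is found summand by summand; extensionality outside the index ranges turns
  this into an equality of triples.\<close>

lemma coords_kernel:
  assumes z: "z \<in> carrier D" and 0: "coords z = \<zero>\<^bsub>W\<^esub>"
  shows "\<exists>y\<in>carrier D. z = y [^]\<^bsub>D\<^esub> p"
proof -
  obtain u v w where uvw: "z = (u, v, w)" "\<And>k. k \<in> {1..r} \<Longrightarrow> fst (u k) \<in> A k" "\<And>k. k \<in> {r+1..r+s} \<Longrightarrow> v k \<in> A k"
    "u \<in> extensional {1..r}" "v \<in> extensional {r+1..r+s}" "w \<in> extensional {1..t}"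
    using z by (rule D_E) blast
  have zero: "coords z i = 0\<^sub>v (fst i)" if "i \<in> jordan_idx p l" for i
    using that by (simp add: 0 jordan_sum_simps card)
  have "\<exists>y. fst y \<in> A k \<and> u k = (of_nat p * fst y, int p * snd y)" if k: "k \<in> {1..r}" for k
    using ecoords_kernel[of k "fst (u k)" "snd (u k)"] uvw(2)[OF k] zero[OF idx_in(1)[OF k]] k
    by (auto simp: uvw(1) coords_u prod_eq_iff)
  then obtain u' where u': "\<And>k. k \<in> {1..r} \<Longrightarrow> fst (u' k) \<in> A k \<and> u k = (of_nat p * fst (u' k), int p * snd (u' k))"
    by metis
  have "\<exists>y\<in>A k. v k = of_nat p * y" if k: "k \<in> {r+1..r+s}" for k
    using jcoords_kernel[of k "v k"] uvw(3)[OF k] zero[OF idx_in(2)[OF k]] k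
    by (auto simp: uvw(1) coords_v)
  then obtain v' where v': "\<And>k. k \<in> {r+1..r+s} \<Longrightarrow> v' k \<in> A k \<and> v k = of_nat p * v' k" by metis
  have "\<exists>y. w k = int p * y" if k: "k \<in> {1..t}" for k
  proof -
    have "vec 1 (\<lambda>_. of_int (w k)) = (0\<^sub>v 1 :: 'p mod_ring vec)"
      using zero[OF idx_in(3)[OF k]] k by (simp add: uvw(1) coords_w)
    then have "vec 1 (\<lambda>_. of_int (w k)) $ 0 = (0\<^sub>v 1 :: 'p mod_ring vec) $ 0" by simp
    then have "(of_int (w k) :: 'p mod_ring) = of_int 0" by simp
    then show ?thesis unfolding of_int_mod_ring_eq_iff card by (simp add: dvd_def)
  qed
  then obtain w' where w': "\<And>k. k \<in> {1..t} \<Longrightarrow> w k = int p * w' k" by metis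
  define y where "y = (\<lambda>k\<in>{1..r}. u' k, \<lambda>k\<in>{r+1..r+s}. v' k, \<lambda>k\<in>{1..t}. w' k)"
  have "y \<in> carrier D" using u' v' by (auto simp: y_def carrier_decomp_group mem_Times_iff)
  moreover have "z = y [^]\<^bsub>D\<^esub> p"
    unfolding uvw(1) y_def nat_pow_decomp_group
    by (intro arg_cong2[of _ _ _ _ Pair] extensionalityI[OF uvw(4) restrict_extensional]
        extensionalityI[OF uvw(5) restrict_extensional] extensionalityI[OF uvw(6) restrict_extensional])
       (use u' v' w' in auto)
  ultimately show ?thesis by blast
qed

lemma coords_act:
  assumes z: "z \<in> carrier D"
  shows "coords (decomp_act \<xi> r s a z) = jordan_sum_act l (coords z)"
proof -
  obtain u v w where uvw: "z = (u, v, w)" "\<And>k. k \<in> {1..r} \<Longrightarrow> fst (u k) \<in> A k" "\<And>k. k \<in> {r+1..r+s} \<Longrightarrow> v k \<in> A k"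
    using z by (rule D_E) blast
  have act: "jordan_sum_act l (coords z) i = jordan_block (fst i) 1 *\<^sub>v coords z i" if "i \<in> jordan_idx p l" for i
    using that by (simp add: jordan_sum_act_def card)
  show ?thesis
  proof (rule W_eqI[OF coords_closed])
    have "coords z i \<in> carrier_vec (fst i)" if "i \<in> jordan_idx p l" for i
      using coords_closed[of z] that unfolding carrier_W by blast
    then show "jordan_sum_act l (coords z) \<in> carrier W"
      unfolding carrier_W jordan_sum_act_def card
      by (intro restrict_PiE_iff[THEN iffD2] ballI mult_mat_vec_carrier[OF jordan_block_carrier])
  next
    fix k assume k: "k \<in> {1..r}"
    show "coords (decomp_act \<xi> r s a z) (idx_u k) = jordan_sum_act l (coords z) (idx_u k)"
      using k ecoords_act[of k "fst (u k)" "snd (u k)"] uvw(2)[OF k] act[OF idx_in(1)[OF k]]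
      by (simp add: uvw(1) decomp_act_def coords_u)
  next
    fix k assume k: "k \<in> {r+1..r+s}"
    show "coords (decomp_act \<xi> r s a z) (idx_v k) = jordan_sum_act l (coords z) (idx_v k)"
      using k jcoords_act[of k "v k"] uvw(3)[OF k] act[OF idx_in(2)[OF k]]
      by (simp add: uvw(1) decomp_act_def coords_v)
  next
    fix k assume k: "k \<in> {1..t}"
    have "jordan_block 1 1 *\<^sub>v x = x" if "x \<in> carrier_vec 1" for x :: "'p mod_ring vec"
      using that by (intro eq_vecI) (auto simp: jordan_block_mult_vec simp del: index_mult_mat_vec)
    then show "coords (decomp_act \<xi> r s a z) (idx_w k) = jordan_sum_act l (coords z) (idx_w k)"
      using k act[OF idx_in(3)[OF k]] by (simp add: uvw(1) decomp_act_def coords_w)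
  qed
qed

text \<open>The kernel condition is pulled back through \<open>f\<close>: a p-th root in the
  decomposition has a preimage in T, and injectivity of \<open>f\<close> identifies its p-th
  power.\<close>

lemma mod_p_reduction_coords:
  assumes T: "comm_group T" and f: "f \<in> iso T D"
  shows "mod_p_reduction T W (coords \<circ> f)"
proof -
  interpret T: comm_group T by (rule T)
  interpret W: module "class_ring :: 'p mod_ring ring" W by (rule module_jordan_sum)
  have D: "group D"
    by (rule group_decomp_group) (use ideals cyclotomic_ideal.ideal in blast)
  have f_hom: "f \<in> hom T D" and f_bij: "bij_betw f (carrier T) (carrier D)"
    using f by (auto simp: iso_def)
  have fD: "f x \<in> carrier D" if "x \<in> carrier T" for x using f_hom that by (auto simp: hom_def)
  show ?thesis
  proof unfold_locales
    show "coords \<circ> f \<in> hom T (add_monoid W)"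
      by (intro homI) (simp_all add: coords_closed coords_mult fD hom_mult[OF f_hom])
    show "(coords \<circ> f) ` carrier T = carrier W"
      unfolding image_comp[symmetric] bij_betw_imp_surj_on[OF f_bij] by (rule coords_surj)
  next
    fix x assume x: "x \<in> carrier T" and "(coords \<circ> f) x = \<zero>\<^bsub>W\<^esub>"
    then obtain z where z: "z \<in> carrier D" "f x = z [^]\<^bsub>D\<^esub> p" using coords_kernel[OF fD[OF x]] by auto
    obtain y where y: "y \<in> carrier T" "z = f y" using f_bij z(1) by (auto simp: bij_betw_def)
    have "f x = f (y [^]\<^bsub>T\<^esub> p)" using z(2) y hom_nat_pow[OF f_hom T.group_axioms D] by simp
    then have "x = y [^]\<^bsub>T\<^esub> p" using f_bij x y T.nat_pow_closed by (auto simp: bij_betw_def dest: inj_onD)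
    then show "\<exists>y\<in>carrier T. x = y [^]\<^bsub>T\<^esub> CARD('p)" using y card by auto
  qed
qed

end


section \<open>Ranks and invariants\<close>

lemma free_of_rank_unique:
  assumes "free_of_rank T m" "free_of_rank T n"
  shows "m = n"
proof -
  have T: "group T" using assms(1) by (simp add: free_of_rank_def comm_group.axioms(2))
  have "free_Abelian_group {..<m} \<cong> T"
    using assms(1) T by (auto simp: free_of_rank_def intro: group.iso_sym)
  then have "free_Abelian_group {..<m} \<cong> free_Abelian_group {..<n}"
    using assms(2) by (auto simp: free_of_rank_def intro: iso_trans)
  then have "{..<m} \<approx> {..<n}" by (simp only: isomorphic_free_Abelian_groups)
  then show ?thesis by (simp add: eqpoll_iff_card)
qed

lemma rk_eqI: "free_of_rank T n \<Longrightarrow> rk T = n"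
  unfolding rk_def by (rule the_equality) (auto dest: free_of_rank_unique)

text \<open>Over a finite index set every element of the product has finite support, so the identity
  map leads to the direct sum.\<close>

lemma product_integer_group_iso: "product_group {1..n} (\<lambda>_. integer_group) \<cong> free_Abelian_group {..<n}"
  for n :: nat
proof -
  have "(\<lambda>x. x) \<in> iso (product_group {1..n} (\<lambda>_. integer_group)) (sum_group {1..n} (\<lambda>_. integer_group))"
    by (intro isoI homI) (auto simp: carrier_sum_group bij_betw_def intro: finite_subset[of _ "{1..n}"])
  then have "product_group {1..n} (\<lambda>_. integer_group) \<cong> sum_group {1..n} (\<lambda>_. integer_group)"
    by (auto simp: is_iso_def)
  also have "\<dots> \<cong> free_Abelian_group {1..n}" by (rule isomorphic_sum_integer_group)
  also have "free_Abelian_group {1..n} \<cong> free_Abelian_group {..<n}"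
    unfolding isomorphic_free_Abelian_groups by (simp add: eqpoll_iff_card)
  finally show ?thesis .
qed

lemma free_of_rankI:
  assumes "comm_group T" "f \<in> iso T (product_group {1..n} (\<lambda>_. integer_group))"
  shows "free_of_rank T n"
  using assms iso_trans[OF _ product_integer_group_iso[of n]] by (auto simp: free_of_rank_def is_iso_def)

lemma free_of_rankE:
  assumes "free_of_rank T n"
  obtains f where "f \<in> iso T (product_group {1..n} (\<lambda>_. integer_group))"
proof -
  have "T \<cong> free_Abelian_group {..<n}" using assms by (simp add: free_of_rank_def)
  also have "\<dots> \<cong> product_group {1..n} (\<lambda>_. integer_group)"
    by (rule group.iso_sym[OF _ product_integer_group_iso]) simp
  finally show ?thesis using that by (auto simp: is_iso_def)
qed

context decomposition
begin

section \<open>The fixed points of \<phi> in the decomposition\<close>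

definition fixed :: "((nat \<Rightarrow> complex \<times> int) \<times> (nat \<Rightarrow> complex) \<times> (nat \<Rightarrow> int)) set" where
  "fixed = {z \<in> carrier D. decomp_act \<xi> r s a z = z}"

text \<open>In (A, a) a fixed vector is determined by its integer part, which runs through p Z;
  dividing by p normalises this to Z. The ideals beyond r contribute nothing, and the trivial
  summands follow at r + 1, ..., r + t.\<close>

definition fixed_coords ::
  "(nat \<Rightarrow> complex \<times> int) \<times> (nat \<Rightarrow> complex) \<times> (nat \<Rightarrow> int) \<Rightarrow> nat \<Rightarrow> int" where
  "fixed_coords = (\<lambda>(u, v, w). \<lambda>i\<in>{1..r+t}. if i \<le> r then snd (u i) div int p else w (i - r))"

lemma xi_neq_1: "\<xi> \<noteq> 1"
  using prime_cyclotomic.theta_nonzero[OF prime_cyclotomic] prime_cyclotomic.\<theta>_def[OF prime_cyclotomic] by auto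

lemma fixed_iff:
  assumes "u \<in> extensional {1..r}" "v \<in> extensional {r+1..r+s}" 
  shows "decomp_act \<xi> r s a (u, v, w) = (u, v, w) \<longleftrightarrow>
    (\<forall>k\<in>{1..r}. ext_act \<xi> (a k) (u k) = u k) \<and> (\<forall>k\<in>{r+1..r+s}. v k = 0)"
proof -
  have "(\<lambda>i\<in>{1..r}. ext_act \<xi> (a i) (u i)) = u \<longleftrightarrow> (\<forall>k\<in>{1..r}. ext_act \<xi> (a k) (u k) = u k)"
    using assms(1) by (auto simp: fun_eq_iff extensional_def restrict_def)
  moreover have "(\<lambda>i\<in>{r+1..r+s}. \<xi> * v i) = v \<longleftrightarrow> (\<forall>k\<in>{r+1..r+s}. v k = 0)"
    using assms(2) xi_neq_1 by (auto simp: fun_eq_iff extensional_def restrict_def)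
  ultimately show ?thesis by (simp add: decomp_act_def)
qed

text \<open>For given k the equation \<theta> x = -k a has at most one solution, as \<theta> is
  nonzero; this is the last clause.\<close>

lemma ext_act_fixed:
  assumes k: "k \<in> {1..r}"
  shows "fst z \<in> A k \<Longrightarrow> ext_act \<xi> (a k) z = z \<Longrightarrow> int p dvd snd z"
    and "\<exists>x\<in>A k. ext_act \<xi> (a k) (x, int p * e) = (x, int p * e)"
    and "ext_act \<xi> (a k) z = z \<Longrightarrow> ext_act \<xi> (a k) z' = z' \<Longrightarrow> snd z = snd z' \<Longrightarrow> z = z'"
proof -
  have k': "k \<in> {1..r+s}" using k by simp
  note iff = cyclotomic_ideal.ext_act_fixed_iff[OF ideals[OF k'] generator[OF k'] generator_not_in[OF k']]
  show "fst z \<in> A k \<Longrightarrow> ext_act \<xi> (a k) z = z \<Longrightarrow> int p dvd snd z"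
    using iff[of "snd z"] by (metis prod.collapse)
  show "\<exists>x\<in>A k. ext_act \<xi> (a k) (x, int p * e) = (x, int p * e)"
    using iff[of "int p * e"] by simp
  show "z = z'" if "ext_act \<xi> (a k) z = z" "ext_act \<xi> (a k) z' = z'" "snd z = snd z'"
  proof -
    have "\<xi> * fst z + of_int (snd z) * a k = fst z" "\<xi> * fst z' + of_int (snd z) * a k = fst z'"
      using that by (auto simp: ext_act_def prod_eq_iff split_beta)
    moreover have "(\<xi> - 1) * x = - c" if "\<xi> * x + c = x" for x c
    proof -
      have "(\<xi> - 1) * x = \<xi> * x + c - x - c" by (simp add: algebra_simps)
      then show ?thesis unfolding that by simp
    qed
    ultimately have "(\<xi> - 1) * fst z = (\<xi> - 1) * fst z'" by metis
    then show ?thesis using xi_neq_1 that(3) by (simp add: prod_eq_iff)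
  qed
qed

lemma fixedE:
  assumes "z \<in> fixed"
  obtains u v w where "z = (u, v, w)" "\<And>k. k \<in> {1..r} \<Longrightarrow> ext_act \<xi> (a k) (u k) = u k" 
    "\<And>k. k \<in> {1..r} \<Longrightarrow> int p dvd snd (u k)"
    "\<And>k. k \<in> {r+1..r+s} \<Longrightarrow> v k = 0"
    "u \<in> extensional {1..r}" "v \<in> extensional {r+1..r+s}" "w \<in> extensional {1..t}"
proof -
  have "z \<in> carrier D" using assms by (simp add: fixed_def)
  then obtain u v w where z: "z = (u, v, w)" "\<And>k. k \<in> {1..r} \<Longrightarrow> fst (u k) \<in> A k" 
    "u \<in> extensional {1..r}" "v \<in> extensional {r+1..r+s}" "w \<in> extensional {1..t}"
    by (rule D_E) blast
  have "(\<forall>k\<in>{1..r}. ext_act \<xi> (a k) (u k) = u k) \<and> (\<forall>k\<in>{r+1..r+s}. v k = 0)"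
    using assms fixed_iff[OF z(3,4)] by (simp add: fixed_def z(1))
  then show ?thesis
    using ext_act_fixed(1)[OF _ z(2)] by (intro that[OF z(1)] z) blast+
qed

lemma fixed_coords_mult:
  assumes "z \<in> fixed" "z' \<in> fixed"
  shows "fixed_coords (z \<otimes>\<^bsub>D\<^esub> z') = (\<lambda>i\<in>{1..r+t}. fixed_coords z i + fixed_coords z' i)"
proof -
  obtain u v w where z: "z = (u, v, w)" "\<And>k. k \<in> {1..r} \<Longrightarrow> int p dvd snd (u k)"
    using assms(1) by (rule fixedE) blast
  obtain u' v' w' where z': "z' = (u', v', w')" "\<And>k. k \<in> {1..r} \<Longrightarrow> int p dvd snd (u' k)"
    using assms(2) by (rule fixedE) blast
  show ?thesis
    unfolding z(1) z'(1) mult_decomp_group fixed_coords_def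
    \<comment> \<open>Division by p is additive here because p divides the integer parts of fixed
      vectors.\<close>
    by (rule ext) (use z(2) z'(2) in \<open>auto simp: restrict_def\<close>)
qed

lemma bij_betw_fixed_coords: "bij_betw fixed_coords fixed (\<Pi>\<^sub>E i\<in>{1..r+t}. UNIV)"
  unfolding bij_betw_def
proof (intro conjI inj_onI)
  fix z z' assume "z \<in> fixed" "z' \<in> fixed" and eq: "fixed_coords z = fixed_coords z'"
  obtain u v w where z: "z = (u, v, w)" "\<And>k. k \<in> {1..r} \<Longrightarrow> ext_act \<xi> (a k) (u k) = u k" 
    "\<And>k. k \<in> {1..r} \<Longrightarrow> int p dvd snd (u k)"  "\<And>k. k \<in> {r+1..r+s} \<Longrightarrow> v k = 0"
    "u \<in> extensional {1..r}" "v \<in> extensional {r+1..r+s}" "w \<in> extensional {1..t}"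
    using \<open>z \<in> fixed\<close> by (rule fixedE) blast
  obtain u' v' w' where z': "z' = (u', v', w')" "\<And>k. k \<in> {1..r} \<Longrightarrow> ext_act \<xi> (a k) (u' k) = u' k" 
    "\<And>k. k \<in> {1..r} \<Longrightarrow> int p dvd snd (u' k)"  "\<And>k. k \<in> {r+1..r+s} \<Longrightarrow> v' k = 0"
    "u' \<in> extensional {1..r}" "v' \<in> extensional {r+1..r+s}" "w' \<in> extensional {1..t}"
    using \<open>z' \<in> fixed\<close> by (rule fixedE) blast
  have "u = u'"
  proof (rule extensionalityI[OF z(5) z'(5)])
    fix k assume k: "k \<in> {1..r}"
    then have "snd (u k) div int p = snd (u' k) div int p"
      using fun_cong[OF eq, of k] by (simp add: fixed_coords_def z(1) z'(1))
    then have "snd (u k) = snd (u' k)" using z(3)[OF k] z'(3)[OF k] by (metis dvd_div_eq_iff)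
    then show "u k = u' k" using ext_act_fixed(3)[OF k z(2)[OF k] z'(2)[OF k]] by simp
  qed
  moreover have "v = v'"
    by (rule extensionalityI[OF z(6) z'(6)]) (simp add: z(4) z'(4))
  moreover have "w = w'"
  proof (rule extensionalityI[OF z(7) z'(7)])
    fix k assume "k \<in> {1..t}"
    then show "w k = w' k" using fun_cong[OF eq, of "r + k"] by (simp add: fixed_coords_def z(1) z'(1))
  qed
  ultimately show "z = z'" by (simp add: z(1) z'(1))
next
  show "fixed_coords ` fixed = (\<Pi>\<^sub>E i\<in>{1..r+t}. UNIV)"
  proof
    show "fixed_coords ` fixed \<subseteq> (\<Pi>\<^sub>E i\<in>{1..r+t}. UNIV)"
      by (auto simp: fixed_coords_def)
    show "(\<Pi>\<^sub>E i\<in>{1..r+t}. UNIV) \<subseteq> fixed_coords ` fixed"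
    proof
      fix y :: "nat \<Rightarrow> int" assume y: "y \<in> (\<Pi>\<^sub>E i\<in>{1..r+t}. UNIV)"
      have "\<forall>k\<in>{1..r}. \<exists>x. x \<in> A k \<and> ext_act \<xi> (a k) (x, int p * y k) = (x, int p * y k)"
        using ext_act_fixed(2) by blast
      then obtain x where x: "\<And>k. k \<in> {1..r} \<Longrightarrow> x k \<in> A k \<and> ext_act \<xi> (a k) (x k, int p * y k) = (x k, int p * y k)"
        using bchoice[of "{1..r}"] by metis
      define u where "u = (\<lambda>k\<in>{1..r}. (x k, int p * y k))"
      define v :: "nat \<Rightarrow> complex" where "v = (\<lambda>k\<in>{r+1..r+s}. 0)"
      define w where "w = (\<lambda>k\<in>{1..t}. y (r + k))"
      have "0 \<in> A k" if "k \<in> {r+1..r+s}" for k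
        by (rule cyclotomic_ideal.A_zero[OF ideals]) (use that in simp)
      then have "(u, v, w) \<in> carrier D" using x by (auto simp: carrier_decomp_group u_def v_def w_def)
      moreover have "decomp_act \<xi> r s a (u, v, w) = (u, v, w)"
        by (subst fixed_iff) (use x in \<open>auto simp: u_def v_def\<close>)
      ultimately have "(u, v, w) \<in> fixed" by (simp add: fixed_def)
      moreover have "fixed_coords (u, v, w) = y"
      proof (rule extensionalityI[of _ "{1..r+t}"])
        fix i assume "i \<in> {1..r+t}"
        then show "fixed_coords (u, v, w) i = y i"
          using p_gt_1 by (auto simp: fixed_coords_def u_def w_def)
      qed (use y in \<open>auto simp: fixed_coords_def PiE_def\<close>)
      ultimately show "y \<in> fixed_coords ` fixed" by blast
    qed
  qed
qed

text \<open>By equivariance and injectivity \<open>f\<close> matches the fixed points in T with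
  \<open>fixed\<close>, whose coordinates are r + t free integers.\<close>

lemma free_of_rank_fixed_points:
  assumes S: "comm_group T" and f: "f \<in> iso T D" and \<phi>: "\<phi> \<in> hom T T"
    and equiv: "\<And>x. x \<in> carrier T \<Longrightarrow> f (\<phi> x) = decomp_act \<xi> r s a (f x)"
  shows "free_of_rank (T\<lparr>carrier := {x \<in> carrier T. \<phi> x = x}\<rparr>) (r + t)"
proof (rule free_of_rankI)
  interpret T: comm_group T by (rule S)
  interpret \<phi>: group_hom T T \<phi> using \<phi> by unfold_locales
  let ?S = "{x \<in> carrier T. \<phi> x = x}"
  have "subgroup ?S T" by (rule T.subgroupI) auto
  then have "group (T\<lparr>carrier := ?S\<rparr>)" by (rule T.subgroup_imp_group)
  then show "comm_group (T\<lparr>carrier := ?S\<rparr>)"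
    by (rule group.group_comm_groupI) (simp add: T.m_comm)
  have f_hom: "f \<in> hom T D" and f_bij: "bij_betw f (carrier T) (carrier D)"
    using f by (auto simp: iso_def)
  have fixed_f: "f x \<in> fixed \<longleftrightarrow> \<phi> x = x" if "x \<in> carrier T" for x
    using that hom_in_carrier[OF f_hom that] \<phi>.hom_closed[OF that] f_bij 
    by (auto simp: fixed_def equiv[symmetric] bij_betw_def dest: inj_onD)
  have fS: "f ` ?S = fixed"
  proof
    show "f ` ?S \<subseteq> fixed" using fixed_f by auto
    show "fixed \<subseteq> f ` ?S"
    proof
      fix z assume "z \<in> fixed"
      moreover from this obtain x where "x \<in> carrier T" "z = f x"
        using f_bij by (auto simp: fixed_def bij_betw_def)
      ultimately show "z \<in> f ` ?S" using fixed_f by auto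
    qed
  qed
  show "fixed_coords \<circ> f \<in> iso (T\<lparr>carrier := ?S\<rparr>) (product_group {1..r+t} (\<lambda>_. integer_group))"
  proof (rule isoI)
    have "bij_betw f ?S fixed"
      using f_bij fS by (auto simp: bij_betw_def intro: inj_on_subset)
    then show "bij_betw (fixed_coords \<circ> f) (carrier (T\<lparr>carrier := ?S\<rparr>)) (carrier (product_group {1..r+t} (\<lambda>_. integer_group)))"
      using bij_betw_trans[OF _ bij_betw_fixed_coords] by simp
    show "fixed_coords \<circ> f \<in> hom (T\<lparr>carrier := ?S\<rparr>) (product_group {1..r+t} (\<lambda>_. integer_group))"
    proof (rule homI)
      fix x assume "x \<in> carrier (T\<lparr>carrier := ?S\<rparr>)"
      then have "f x \<in> fixed" using fS by auto
      then show "(fixed_coords \<circ> f) x \<in> carrier (product_group {1..r+t} (\<lambda>_. integer_group))"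
        using bij_betw_fixed_coords by (auto simp: bij_betw_def)
    next
      fix x y assume "x \<in> carrier (T\<lparr>carrier := ?S\<rparr>)" "y \<in> carrier (T\<lparr>carrier := ?S\<rparr>)"
      then have xy: "x \<in> carrier T" "y \<in> carrier T" "f x \<in> fixed" "f y \<in> fixed" using fixed_f by auto
      then show "(fixed_coords \<circ> f) (x \<otimes>\<^bsub>T\<lparr>carrier := ?S\<rparr>\<^esub> y) =
          (fixed_coords \<circ> f) x \<otimes>\<^bsub>product_group {1..r+t} (\<lambda>_. integer_group)\<^esub> (fixed_coords \<circ> f) y"
        using fixed_coords_mult[OF xy(3,4)] hom_mult[OF f_hom xy(1,2)] by simp
    qed
  qed
qed

end

section \<open>Rank by counting modulo p, and invariants of the whole group\<close>

lemma sum_decomp_mult: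
  assumes "1 < p"
  shows "(\<Sum>q=1..p. decomp_mult p r s t q * q) = t + (p - 1) * s + p * r"
proof -
  have "(\<Sum>q=1..p. decomp_mult p r s t q * q) =
    (\<Sum>q=1..p. (if q = p then r * p else 0) + (if q = p - 1 then s * (p - 1) else 0) + (if q = 1 then t else 0))"
    by (intro sum.cong) (auto simp: decomp_mult_def add_mult_distrib)
  also have "\<dots> = r * p + s * (p - 1) + t"
    unfolding sum.distrib using assms by (subst sum.delta, simp)+ auto
  finally show ?thesis by (simp add: mult.commute)
qed

text \<open>A free group of rank n is the degenerate decomposition with r = s = 0 and t = n, so the
  machinery for T also counts its reduction.\<close>

lemma card_Fp_tensor_free:
  assumes "free_of_rank T n" "primitive_root_of_unity CARD('p::prime_card) \<xi>"
  shows "card (carrier (Fp_tensor TYPE('p) T)) = CARD('p) ^ n"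
proof -
  interpret triv: decomposition \<xi> "CARD('p)" 0 0 n "\<lambda>_. {}" "\<lambda>_. 0" "TYPE('p)"
    using assms(2) prime_card[where 'a='p] by unfold_locales auto
  obtain f where f: "f \<in> iso T (product_group {1..n} (\<lambda>_. integer_group))"
    using free_of_rankE[OF assms(1)] .
  \<comment> \<open>Over an empty index range the constant \<open>undefined\<close> is the only
    extensional function, hence the only possible first two components.\<close>
  have "(\<lambda>w. (\<lambda>_. undefined, \<lambda>_. undefined, w)) \<in> iso (product_group {1..n} (\<lambda>_. integer_group)) triv.D"
    by (intro isoI homI bij_betwI[where g = "\<lambda>(u, v, w). w"])
       (auto simp: carrier_decomp_group mult_decomp_group restrict_def)
  from iso_set_trans[OF f this]
  interpret mod_p_reduction T triv.W "triv.coords \<circ> ((\<lambda>w. (\<lambda>_. undefined, \<lambda>_. undefined, w)) \<circ> f)"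
    using assms(1) by (intro triv.mod_p_reduction_coords) (auto simp: free_of_rank_def)
  show ?thesis
    using sum_decomp_mult[of "CARD('p)" 0 0 n] triv.p_gt_1
    by (simp add: card_carrier_Fp_tensor card_jordan_sum)
qed

text \<open>A point fixed by the generator is fixed by its inverse and by all products; evaluation
  must stay in the carrier, as composition in \<open>AutoGroup\<close> is restricted to it.\<close>

lemma invariants_generate:
  assumes T: "group T" and G: "G = generate (AutoGroup T) {\<phi>}" and \<phi>: "\<phi> \<in> auto T"
  shows "invariants T G = T\<lparr>carrier := {x \<in> carrier T. \<phi> x = x}\<rparr>"
proof -
  interpret Aut: group "AutoGroup T" by (rule group.AutoGroup[OF T])
  have mult: "(g \<otimes>\<^bsub>AutoGroup T\<^esub> h) x = g (h x)" 
    if "g \<in> carrier (AutoGroup T)" "h \<in> carrier (AutoGroup T)" "x \<in> carrier T" for g h x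
    using that by (simp add: AutoGroup_def BijGroup_def auto_def compose_def)
  have one_apply: "\<one>\<^bsub>AutoGroup T\<^esub> x = x" if "x \<in> carrier T" for x
    using that by (simp add: AutoGroup_def BijGroup_def)
  have \<phi>': "\<phi> \<in> carrier (AutoGroup T)" using \<phi> by (simp add: AutoGroup_def)
  have "g x = x" if "g \<in> generate (AutoGroup T) {\<phi>}" and x: "x \<in> carrier T" "\<phi> x = x" for g x
    using that(1)
  proof (induction rule: generate.induct)
    case one
    show ?case by (rule one_apply[OF x(1)])
  next
    case (incl h)
    then show ?case using x(2) by simp
  next
    case (inv h)
    have "(inv\<^bsub>AutoGroup T\<^esub> \<phi>) (\<phi> x) = x"
      using mult[OF Aut.inv_closed[OF \<phi>'] \<phi>' x(1)] Aut.l_inv[OF \<phi>'] one_apply[OF x(1)] by simp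
    then show ?case using inv x(2) by simp
  next
    case (eng g h)
    then show ?case using mult[of g h x] Aut.generate_in_carrier[of "{\<phi>}"] \<phi>' x(1) by simp
  qed
  moreover have "\<phi> \<in> G" unfolding G by (intro generate.incl) simp
  ultimately have "{x \<in> carrier T. \<forall>g\<in>G. g x = x} = {x \<in> carrier T. \<phi> x = x}"
    unfolding G by blast
  then show ?thesis by (simp add: invariants_def)
qed


theorem theorem2p10:
  fixes T :: "('a, 'm) monoid_scheme"
    and G :: "('a \<Rightarrow> 'a) set" and \<phi> :: "'a \<Rightarrow> 'a"
    and \<xi> :: complex
    and p n r l_minus l_plus :: nat
  assumes p: "prime p" "CARD('p::prime_card) = p"
    and T: "free_of_rank T n"
    and G: "subgroup G (AutoGroup T)" "card G = p" "G = generate (AutoGroup T) {\<phi>}" "\<phi> \<in> G"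
    and \<xi>: "primitive_root_of_unity p \<xi>"
    and decomp: "has_decomposition \<xi> T \<phi> r l_minus l_plus"
  shows "ell TYPE('p) T \<phi> p = r \<and>
    (p \<ge> 3 \<longrightarrow> l_plus = ell TYPE('p) T \<phi> 1 \<and> l_minus = ell TYPE('p) T \<phi> (p - 1)) \<and>
    (p = 2 \<longrightarrow> ell TYPE('p) T \<phi> 1 = l_plus + l_minus) \<and>
    (\<forall>q. 2 \<le> q \<and> q \<le> p - 2 \<longrightarrow> ell TYPE('p) T \<phi> q = 0) \<and>
    rk T = l_plus + (p - 1) * l_minus + p * ell TYPE('p) T \<phi> p \<and>
    rk (invariants T G) = l_plus + ell TYPE('p) T \<phi> p"
proof -
  interpret T: comm_group T using T by (simp add: free_of_rank_def)
  have \<phi>_auto: "\<phi> \<in> auto T"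
    using subgroup.mem_carrier[OF G(1,4)] by (simp add: AutoGroup_def)
  then have \<phi>: "\<phi> \<in> hom T T" by (simp add: auto_def)
  have p_gt_1: "1 < p" using p(1) by (rule prime_gt_1_nat)
  obtain A a f where ideals: "\<And>i. i \<in> {1..r+l_minus} \<Longrightarrow> ideal (A i) (Z_adjoin \<xi>) \<and> A i \<noteq> {0}"
    and a: "\<And>i. i \<in> {1..r} \<Longrightarrow> a i \<in> A i \<and> a i \<notin> (\<lambda>x. (\<xi> - 1) * x) ` A i"
    and f: "f \<in> iso T (decomp_group r l_minus l_plus A)"
    and f_act: "\<And>x. x \<in> carrier T \<Longrightarrow> f (\<phi> x) = decomp_act \<xi> r l_minus a (f x)"
    using decomp unfolding has_decomposition_def ZG_isomorphic_def by blast
  have cyclotomic: "cyclotomic_ideal \<xi> p (A i)" if "i \<in> {1..r+l_minus}" for i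
  proof (intro cyclotomic_ideal.intro cyclotomic_ideal_axioms.intro prime_cyclotomic.intro)
    show "x = 0" if "x \<in> A i" "\<And>k. \<exists>y\<in>A i. x = of_nat p ^ k * y" for x
      by (rule ideal_separated_of_free[OF T f _ \<open>i \<in> {1..r+l_minus}\<close> p_gt_1 that])
         (use ideals in blast)
  qed (use p(1) \<xi> ideals[OF that] in simp_all)
  \<comment> \<open>The decomposition names no element for i > r, so one has to be found to start
    the chain there.\<close>
  have "\<exists>b. b \<in> A i \<and> b \<notin> (\<lambda>x. (\<xi> - 1) * x) ` A i" if "i \<in> {1..r+l_minus}" for i
  proof -
    interpret cyclotomic_ideal \<xi> p "A i" by (rule cyclotomic[OF that])
    obtain g where "g \<in> A i" "g \<notin> \<theta>A" by (rule ex_generator_mod_thetaA)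
    then show ?thesis unfolding \<theta>_def by (intro exI[of _ g] conjI)
  qed
  then obtain b where b: "\<And>i. i \<in> {1..r+l_minus} \<Longrightarrow> b i \<in> A i \<and> b i \<notin> (\<lambda>x. (\<xi> - 1) * x) ` A i"
    by metis
  \<comment> \<open>The given elements are kept up to r, because the action on (A_i, a_i) depends on
    them.\<close>
  define c where "c i = (if i \<le> r then a i else b i)" for i
  interpret decomposition \<xi> p r l_minus l_plus A c "TYPE('p)"
  proof (rule decomposition.intro)
    show "c i \<in> A i \<and> c i \<notin> (\<lambda>x. (\<xi> - 1) * x) ` A i" if "i \<in> {1..r+l_minus}" for i
      using a[of i] b[OF that] that by (cases "i \<le> r") (simp_all add: c_def)
  qed (use p \<xi> cyclotomic in simp_all)
  \<comment> \<open>The action reads the family of elements only at indices up to r, where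
    \<open>c\<close> and \<open>a\<close> agree.\<close>
  have f_act': "f (\<phi> x) = decomp_act \<xi> r l_minus c (f x)" if "x \<in> carrier T" for x
    using f_act[OF that] by (auto simp: decomp_act_def c_def split_beta intro!: restrict_ext)
  have fD: "f x \<in> carrier D" if "x \<in> carrier T" for x
    using f that by (auto simp: iso_def hom_def)
  have red: "mod_p_reduction T W (coords \<circ> f)"
    by (rule mod_p_reduction_coords[OF T.comm_group_axioms f])
  interpret mod_p_reduction T W "coords \<circ> f" by (rule red)
  have ell: "ell TYPE('p) T \<phi> q = decomp_mult p r l_minus l_plus q" if "1 \<le> q" "q \<le> p" for q
    by (rule ell_eq[OF red \<phi>]) (use that p fD coords_act f_act' in auto)
  \<comment> \<open>Two counts of the same reduction: through a basis of T on the left, through the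
    Jordan blocks on the right. Comparing exponents gives the rank.\<close>
  have "CARD('p) ^ n = CARD('p) ^ (l_plus + (p - 1) * l_minus + p * r)"
    using card_Fp_tensor_free[OF T, where 'p='p and \<xi>=\<xi>] \<xi> p_gt_1 sum_decomp_mult[OF p_gt_1, of r l_minus l_plus]
    by (simp add: p card_carrier_Fp_tensor card_jordan_sum)
  then have "rk T = l_plus + (p - 1) * l_minus + p * r"
    using rk_eqI[OF T] p_gt_1 by (simp add: p)
  moreover have "rk (invariants T G) = l_plus + r"
    unfolding invariants_generate[OF T.group_axioms G(3) \<phi>_auto]
    using rk_eqI[OF free_of_rank_fixed_points[OF T.comm_group_axioms f \<phi> f_act']] by simp
  ultimately show ?thesis
    using p_gt_1 ell by (auto simp: decomp_mult_def)
qed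

end
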